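(* For all fixed $d,h\ge2$, as $k\to\infty$: $$\#\mathrm{detFstates}^h_d(k)=O(k^{(d-1)h-d+2}),$$ $$\#\mathrm{detBstates}^h_d(k)=O\!\left(k^{(d-1)h-d+2}/\log k\right)\ \text{ if } h\ge 3,$$ $$\#\mathrm{ndetBstates}^h_d(k)=O(k^{(d-1)h/2+1}).$$ Moreover the first and third bounds are achieved by thrifty branching programs.
   Context: $T^h_d$ is the balanced rooted $d$-ary tree with $h$ levels. An instance with parameter $k$ assigns to each internal node $i$ a function $f_i:[k]^d\to[k]$ (given by its $k^d$ values) and to each leaf an element of $[k]=\{1,\dots,k\}$; $v_i$ is the leaf label for a leaf and $v_i=f_i(v_{j_1},\dots,v_{j_d})$ for an internal node with children $j_1,\dots,j_d$. $FT^h_d(k)$: output the root value; $BT^h_d(k)$: decide whether it is $1$. The $k$-ary input variables are $f_i(x)$ (internal $i$, $x\in[k]^d$) and one per leaf. A nondeterministic $k$-way branching program computing $g:[k]^m\to R$ is a directed rooted multigraph of states, edges labelled by elements of $[k]$, nonfinal states labelled by variable indices, $|R|$ final sink states labelled by elements of $R$; on input $x$, edges labelled $x_j$ out of states labelled $j$ are activated; each computation (path of activated edges from the root) is infinite, ends in the final state labelled $g(x)$, or aborts, and at least one ends in a final state. Deterministic: every nonfinal state has exactly $k$ outedges labelled $1,\dots,k$. A deterministic program is thrifty if on every input every query to $f_i(x)$ of an internal node $i$ has $x$ equal to the correct values of the children of $i$; a nondeterministic one is thrifty if this holds along every computation ending in a final state. $\#\mathrm{detFstates}^h_d(k)$ is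 the minimum number of states of a deterministic $k$-way program computing $FT^h_d(k)$; $\#\mathrm{detBstates}^h_d(k)$, $\#\mathrm{ndetBstates}^h_d(k)$ are the minima for deterministic/nondeterministic programs solving $BT^h_d(k)$. *)

theory Defs
  imports Complex_Main "HOL-Library.Multiset" "HOL-Library.FuncSet" "HOL-Library.Landau_Symbols"
begin

datatype ('v, 'r) state_label = Query 'v | Final 'r

text \<open>
  The edges form a multiset of triples (source, edge label, target), so that a program is a
  directed multigraph. The set \<open>{1..k}\<close> of naturals plays the role of \<open>[k]\<close>.
\<close>

record ('s, 'v, 'r) bprog =
  bp_states :: "'s set"
  bp_root   :: 's
  bp_label  :: "'s \<Rightarrow> ('v, 'r) state_label"
  bp_edges  :: "('s \<times> nat \<times> 's) multiset"

definition final_state :: "('s, 'v, 'r) bprog \<Rightarrow> 's \<Rightarrow> bool" where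
  "final_state B s \<longleftrightarrow> (\<exists>r. bp_label B s = Final r)"

definition branching_program :: "nat \<Rightarrow> 'v set \<Rightarrow> 'r set \<Rightarrow> ('s, 'v, 'r) bprog \<Rightarrow> bool" where
  "branching_program k V R B \<longleftrightarrow>
     finite (bp_states B) \<and>
     bp_root B \<in> bp_states B \<and>
     (\<forall>s \<in> bp_states B. \<forall>q. bp_label B s = Query q \<longrightarrow> q \<in> V) \<and>
     (\<forall>s \<in> bp_states B. \<forall>r. bp_label B s = Final r \<longrightarrow> r \<in> R) \<and>
     (\<forall>r \<in> R. \<exists>!s. s \<in> bp_states B \<and> bp_label B s = Final r) \<and>
     (\<forall>(s, a, t) \<in># bp_edges B.
        s \<in> bp_states B \<and> \<not> final_state B s \<and> a \<in> {1..k} \<and> t \<in> bp_states B)"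

definition deterministic :: "nat \<Rightarrow> ('s, 'v, 'r) bprog \<Rightarrow> bool" where
  "deterministic k B \<longleftrightarrow>
     (\<forall>s \<in> bp_states B. \<not> final_state B s \<longrightarrow>
        image_mset (\<lambda>(_, a, _). a) (filter_mset (\<lambda>(u, _, _). u = s) (bp_edges B)) = mset_set {1..k})"

definition activated :: "('s, 'v, 'r) bprog \<Rightarrow> ('v \<Rightarrow> nat) \<Rightarrow> 's \<Rightarrow> 's \<Rightarrow> bool" where
  "activated B x s t \<longleftrightarrow> (\<exists>q. bp_label B s = Query q \<and> (s, x q, t) \<in># bp_edges B)"

text \<open>Finite paths of activated edges from the root, given by the list of states visited.\<close>

definition activated_path :: "('s, 'v, 'r) bprog \<Rightarrow> ('v \<Rightarrow> nat) \<Rightarrow> 's list \<Rightarrow> bool" where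
  "activated_path B x p \<longleftrightarrow> p \<noteq> [] \<and> hd p = bp_root B \<and> successively (activated B x) p"

text \<open>
  A finite computation is an activated path that cannot be prolonged; it aborts if its last state
  is nonfinal. Infinite computations are always permitted and never constrain a program, so they
  are not represented.
\<close>

definition finite_computation :: "('s, 'v, 'r) bprog \<Rightarrow> ('v \<Rightarrow> nat) \<Rightarrow> 's list \<Rightarrow> bool" where
  "finite_computation B x p \<longleftrightarrow> activated_path B x p \<and> \<not> (\<exists>t. activated B x (last p) t)"

definition computes :: "nat \<Rightarrow> 'v set \<Rightarrow> ('s, 'v, 'r) bprog \<Rightarrow> (('v \<Rightarrow> nat) \<Rightarrow> 'r) \<Rightarrow> bool" where
  "computes k V B g \<longleftrightarrow>
     (\<forall>x \<in> V \<rightarrow>\<^sub>E {1..k}.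
        (\<forall>p. finite_computation B x p \<longrightarrow>
             bp_label B (last p) = Final (g x) \<or> \<not> final_state B (last p)) \<and>
        (\<exists>p. finite_computation B x p \<and> final_state B (last p)))"

definition bp_size :: "('s, 'v, 'r) bprog \<Rightarrow> nat" where
  "bp_size B = card (bp_states B)"

text \<open>
  A node of the balanced \<open>d\<close>-ary tree with \<open>h\<close> levels is addressed by the list of child indices
  (each below \<open>d\<close>) leading to it from the root \<open>[]\<close>; the children of \<open>i\<close> are \<open>i @ [j]\<close> for
  \<open>j < d\<close>, and the leaves are the addresses of length \<open>h - 1\<close>.
\<close>

type_synonym node = "nat list"

definition internal_nodes :: "nat \<Rightarrow> nat \<Rightarrow> node set" where
  "internal_nodes d h = {i. set i \<subseteq> {..<d} \<and> Suc (length i) < h}"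

definition leaves :: "nat \<Rightarrow> nat \<Rightarrow> node set" where
  "leaves d h = {i. set i \<subseteq> {..<d} \<and> Suc (length i) = h}"

text \<open>\<open>FunVal i a\<close> is the variable holding the value of the function of node \<open>i\<close> at \<open>a\<close>.\<close>

datatype tree_var = FunVal node "nat list" | LeafVal node

definition tree_vars :: "nat \<Rightarrow> nat \<Rightarrow> nat \<Rightarrow> tree_var set" where
  "tree_vars d h k =
     {FunVal i a | i a. i \<in> internal_nodes d h \<and> length a = d \<and> set a \<subseteq> {1..k}} \<union>
     LeafVal ` leaves d h"

text \<open>The value of node \<open>i\<close>, given that \<open>i\<close> has distance \<open>n\<close> from the leaves.\<close>

primrec value_above :: "nat \<Rightarrow> (tree_var \<Rightarrow> nat) \<Rightarrow> nat \<Rightarrow> node \<Rightarrow> nat" where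
  "value_above d x 0 i = x (LeafVal i)"
| "value_above d x (Suc n) i = x (FunVal i (map (\<lambda>j. value_above d x n (i @ [j])) [0..<d]))"

definition node_value :: "nat \<Rightarrow> nat \<Rightarrow> (tree_var \<Rightarrow> nat) \<Rightarrow> node \<Rightarrow> nat" where
  "node_value d h x i = value_above d x (h - 1 - length i) i"

definition FT :: "nat \<Rightarrow> nat \<Rightarrow> (tree_var \<Rightarrow> nat) \<Rightarrow> nat" where
  "FT d h x = node_value d h x []"

definition BT :: "nat \<Rightarrow> nat \<Rightarrow> (tree_var \<Rightarrow> nat) \<Rightarrow> bool" where
  "BT d h x \<longleftrightarrow> node_value d h x [] = 1"

definition thrifty_at :: "nat \<Rightarrow> nat \<Rightarrow> ('s, tree_var, 'r) bprog \<Rightarrow> (tree_var \<Rightarrow> nat) \<Rightarrow> 's \<Rightarrow> bool" where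
  "thrifty_at d h B x s \<longleftrightarrow>
     (\<forall>i a. bp_label B s = Query (FunVal i a) \<longrightarrow>
            a = map (\<lambda>j. node_value d h x (i @ [j])) [0..<d])"

definition det_thrifty :: "nat \<Rightarrow> nat \<Rightarrow> nat \<Rightarrow> ('s, tree_var, 'r) bprog \<Rightarrow> bool" where
  "det_thrifty d h k B \<longleftrightarrow>
     (\<forall>x \<in> tree_vars d h k \<rightarrow>\<^sub>E {1..k}. \<forall>p. activated_path B x p \<longrightarrow>
        (\<forall>s \<in> set p. thrifty_at d h B x s))"

definition ndet_thrifty :: "nat \<Rightarrow> nat \<Rightarrow> nat \<Rightarrow> ('s, tree_var, 'r) bprog \<Rightarrow> bool" where
  "ndet_thrifty d h k B \<longleftrightarrow>
     (\<forall>x \<in> tree_vars d h k \<rightarrow>\<^sub>E {1..k}. \<forall>p. finite_computation B x p \<and> final_state B (last p) \<longrightarrow>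
        (\<forall>s \<in> set p. thrifty_at d h B x s))"

text \<open>
  Programs have finitely many states, so natural numbers suffice as states. The output set of the
  decision problem is \<open>bool\<close>: a program for it has one accepting and one rejecting final state,
  also in the nondeterministic case.
\<close>

definition det_solves_FT :: "nat \<Rightarrow> nat \<Rightarrow> nat \<Rightarrow> (nat, tree_var, nat) bprog \<Rightarrow> bool" where
  "det_solves_FT d h k B \<longleftrightarrow>
     branching_program k (tree_vars d h k) {1..k} B \<and> deterministic k B \<and>
     computes k (tree_vars d h k) B (FT d h)"

definition ndet_solves_BT :: "nat \<Rightarrow> nat \<Rightarrow> nat \<Rightarrow> (nat, tree_var, bool) bprog \<Rightarrow> bool" where
  "ndet_solves_BT d h k B \<longleftrightarrow>
     branching_program k (tree_vars d h k) UNIV B \<and>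
     computes k (tree_vars d h k) B (BT d h)"

definition det_solves_BT :: "nat \<Rightarrow> nat \<Rightarrow> nat \<Rightarrow> (nat, tree_var, bool) bprog \<Rightarrow> bool" where
  "det_solves_BT d h k B \<longleftrightarrow> ndet_solves_BT d h k B \<and> deterministic k B"

definition detFstates :: "nat \<Rightarrow> nat \<Rightarrow> nat \<Rightarrow> nat" where
  "detFstates d h k = (LEAST n. \<exists>B. det_solves_FT d h k B \<and> bp_size B = n)"

definition detBstates :: "nat \<Rightarrow> nat \<Rightarrow> nat \<Rightarrow> nat" where
  "detBstates d h k = (LEAST n. \<exists>B. det_solves_BT d h k B \<and> bp_size B = n)"

definition ndetBstates :: "nat \<Rightarrow> nat \<Rightarrow> nat \<Rightarrow> nat" where
  "ndetBstates d h k = (LEAST n. \<exists>B. ndet_solves_BT d h k B \<and> bp_size B = n)"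

end

theory Submission imports Defs begin

text \<open>
  A program is written as a computation tree in continuation-passing style, and its states are the
  distinct subtrees; equal residual computations are thereby identified, and the size of a program
  is the number of values that its pending continuations can remember.

  Depth-first evaluation of \<open>FT\<close> remembers at most \<open>d - 1\<close> values on each level, plus
  one more at the bottom. To save the logarithm for \<open>BT\<close>, evaluate the last child of the
  root first and keep only the block of \<open>b\<close> values, \<open>4\<^sup>b \<le> k\<close>, that contains
  it; evaluate the other children, tabulate the test ``root value is 1'' on that block as
  \<open>b\<close> bits, forget everything else, and evaluate the last child again.

  The nondeterministic program writes values in base \<open>q \<approx> \<surd>k\<close>. At each node it
  evaluates all children but the last, keeping only the high digits, then starts on the last child. Once
  the value of that child is claimed, it guesses the low digits and queries the function of
  the node; the high digits can now be dropped, and the low digits are checked by evaluating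
  the children again, after the pending checks below the last child. So at any time a level holds only
  one digit per child, that is \<open>(d - 1) / 2\<close> values.
\<close>

subsection \<open>Computation trees as branching programs\<close>

text \<open>The answer to a query selects a list of successors: one entry is a deterministic move,
  several entries are a guess, and the empty list aborts.\<close>

datatype ('v, 'r) ptree = Ask 'v "nat \<Rightarrow> ('v, 'r) ptree list" | Out 'r

text \<open>Only answers in \<open>{1..k}\<close> are followed: the branching function is defined on
  all naturals, so without this restriction there could be infinitely many subtrees.\<close>

inductive subtree :: "nat \<Rightarrow> ('v, 'r) ptree \<Rightarrow> ('v, 'r) ptree \<Rightarrow> bool" for k where
  self: "subtree k t t"
| child: "a \<in> {1..k} \<Longrightarrow> t \<in> set (\<kappa> a) \<Longrightarrow> subtree k s t \<Longrightarrow> subtree k s (Ask q \<kappa>)"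

abbreviation subtrees :: "nat \<Rightarrow> ('v, 'r) ptree \<Rightarrow> ('v, 'r) ptree set" where
  "subtrees k t \<equiv> {s. subtree k s t}"

lemma subtree_closed:
  assumes "subtree k (Ask q \<kappa>) t" "a \<in> {1..k}" "s \<in> set (\<kappa> a)"
  shows "subtree k s t"
  using assms
  by (induction "Ask q \<kappa>" t rule: subtree.induct) (auto intro: subtree.intros)

lemma subtree_Out [simp]: "subtree k s (Out r) \<longleftrightarrow> s = Out r"
  by (auto intro: subtree.intros elim: subtree.cases)

fun ptree_label :: "('v, 'r) ptree \<Rightarrow> ('v, 'r) state_label" where
  "ptree_label (Ask q \<kappa>) = Query q"
| "ptree_label (Out r) = Final r"

text \<open>The first rule may stop at any node. Traces therefore mirror all activated paths from
  the root, not only the maximal ones; deterministic thriftiness constrains every such path.\<close>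

inductive trace :: "('v \<Rightarrow> nat) \<Rightarrow> ('v, 'r) ptree \<Rightarrow> ('v, 'r) state_label list \<Rightarrow> bool" for x where
  "trace x t [ptree_label t]"
| "t \<in> set (\<kappa> (x q)) \<Longrightarrow> trace x t ls \<Longrightarrow> trace x (Ask q \<kappa>) (Query q # ls)"

section \<open>Counting distinct subtrees\<close>

definition forest :: "nat \<Rightarrow> ('v, 'r) ptree set \<Rightarrow> ('v, 'r) ptree set" where
  "forest k X = {s. \<exists>t\<in>X. subtree k s t}"

lemma forest_mono: "X \<subseteq> Y \<Longrightarrow> forest k X \<subseteq> forest k Y"
  by (auto simp: forest_def)

lemma forest_UN: "forest k (\<Union>i\<in>I. X i) = (\<Union>i\<in>I. forest k (X i))"
  by (auto simp: forest_def)

text \<open>\<open>Y\<close> is the set of continuations of \<open>X\<close>; the costs \<open>c\<close> add up along composition.\<close>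

definition covers :: "nat \<Rightarrow> ('v, 'r) ptree set \<Rightarrow> nat \<Rightarrow> ('v, 'r) ptree set \<Rightarrow> ('v, 'r) ptree set \<Rightarrow> bool" where
  "covers k A c X Y \<longleftrightarrow>
     (\<exists>N. N \<subseteq> A \<and> finite N \<and> card N \<le> c \<and> forest k X \<subseteq> N \<union> forest k Y)"

lemma covers_mono:
  assumes "covers k A c X Y" "c \<le> c'" "X' \<subseteq> X" "Y \<subseteq> Y'"
  shows "covers k A c' X' Y'"
proof -
  obtain N where N: "N \<subseteq> A" "finite N" "card N \<le> c" "forest k X \<subseteq> N \<union> forest k Y"
    using assms(1) unfolding covers_def by auto
  have "forest k X' \<subseteq> N \<union> forest k Y'"
    using N(4) forest_mono[OF assms(3), of k] forest_mono[OF assms(4), of k] by blast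
  with N assms(2) show ?thesis
    unfolding covers_def by (intro exI[of _ N]) auto
qed

lemma covers_subset: "X \<subseteq> Y \<Longrightarrow> covers k A 0 X Y"
  unfolding covers_def by (intro exI[of _ "{}"]) (simp add: forest_mono)

lemma covers_trans:
  assumes "covers k A c X Y" "covers k A c' Y Z"
  shows "covers k A (c + c') X Z"
proof -
  obtain N N' where "N \<subseteq> A" "finite N" "card N \<le> c" "forest k X \<subseteq> N \<union> forest k Y"
      "N' \<subseteq> A" "finite N'" "card N' \<le> c'" "forest k Y \<subseteq> N' \<union> forest k Z"
    using assms unfolding covers_def by auto
  then show ?thesis
    unfolding covers_def using card_Un_le[of N N']
    by (intro exI[of _ "N \<union> N'"] conjI) (simp_all, blast)
qed

lemma covers_UN:
  assumes "finite I" "card I \<le> m" "\<And>i. i \<in> I \<Longrightarrow> covers k A c (X i) Y"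
  shows "covers k A (m * c) (\<Union>i\<in>I. X i) Y"
proof -
  obtain N where N: "\<And>i. i \<in> I \<Longrightarrow> N i \<subseteq> A \<and> finite (N i) \<and> card (N i) \<le> c \<and>
      forest k (X i) \<subseteq> N i \<union> forest k Y"
    using assms(3) unfolding covers_def by metis
  have "card (\<Union>i\<in>I. N i) \<le> (\<Sum>i\<in>I. card (N i))"
    by (rule card_UN_le[OF assms(1)])
  also have "\<dots> \<le> (\<Sum>i\<in>I. c)"
    by (rule sum_mono) (use N in auto)
  also have "\<dots> \<le> m * c"
    using assms(2) by simp
  finally have "card (\<Union>i\<in>I. N i) \<le> m * c" .
  moreover have "forest k (\<Union>i\<in>I. X i) \<subseteq> (\<Union>i\<in>I. N i) \<union> forest k Y"
    unfolding forest_UN using N by blast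
  moreover have "(\<Union>i\<in>I. N i) \<subseteq> A" "finite (\<Union>i\<in>I. N i)"
    using N assms(1) by auto
  ultimately show ?thesis
    unfolding covers_def by blast
qed

lemma covers_image:
  assumes "finite I" "card I \<le> m" "\<And>i. i \<in> I \<Longrightarrow> covers k A c {f i} Y"
  shows "covers k A (m * c) (f ` I) Y"
  proof -
  have "f ` I = (\<Union>i\<in>I. {f i})" by auto
  with covers_UN[of I m k A c "\<lambda>i. {f i}" Y] assms show ?thesis by metis
qed

lemma covers_Ask:
  assumes "Ask q \<kappa> \<in> A"
  shows "covers k A 1 {Ask q \<kappa>} (\<Union>a\<in>{1..k}. set (\<kappa> a))"
proof -
  have "forest k {Ask q \<kappa>} \<subseteq> {Ask q \<kappa>} \<union> forest k (\<Union>a\<in>{1..k}. set (\<kappa> a))"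
    by (force simp: forest_def elim: subtree.cases)
  with assms show ?thesis
    unfolding covers_def by (intro exI[of _ "{Ask q \<kappa>}"]) auto
qed

section \<open>From computation trees to programs\<close>

lemma computesI:
  assumes "\<And>x p r. x \<in> V \<rightarrow>\<^sub>E {1..k} \<Longrightarrow> activated_path B x p \<Longrightarrow> bp_label B (last p) = Final r \<Longrightarrow> r = g x"
    and "\<And>x. x \<in> V \<rightarrow>\<^sub>E {1..k} \<Longrightarrow> \<exists>p. activated_path B x p \<and> bp_label B (last p) = Final (g x)"
  shows "computes k V B g"
proof -
  \<comment> \<open>A final state queries nothing, so no activated edge leaves it: a path that ends
    in a final state is automatically a finite computation.\<close>
  have "\<not> activated B x (last p) t" if "bp_label B (last p) = Final r" for x p t r
    using that by (simp add: activated_def)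
  then show ?thesis
    using assms unfolding computes_def finite_computation_def final_state_def by metis
qed

text \<open>\<open>ask_trees\<close> and \<open>det_trees\<close> are the two values used for the
  parameter \<open>A\<close> of \<open>covers\<close>. A bound on the number of states thus also
  certifies that every query is legal and, for \<open>det_trees\<close>, that every answer has a
  single successor.\<close>

definition ask_trees :: "'v set \<Rightarrow> ('v, 'r) ptree set" where
  "ask_trees V = {Ask q \<kappa> | q \<kappa>. q \<in> V}"

definition det_trees :: "'v set \<Rightarrow> ('v, 'r) ptree set" where
  "det_trees V = {Ask q (\<lambda>a. [\<kappa> a]) | q \<kappa>. q \<in> V}"

lemma det_trees_subset: "det_trees V \<subseteq> ask_trees V"
  unfolding det_trees_def ask_trees_def by auto

text \<open>The states are subtrees taken as values, numbered by an injection, so equal residual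
  computations share a state and the \<open>covers\<close> bound counts exactly what is needed.
  Paths and traces correspond, which reduces all semantic claims about the program to the
  tree.\<close>

lemma program_of_ptree:
  fixes t :: "('v, 'r) ptree"
  assumes cov: "covers k A c {t} (Out ` R)" and A: "A \<subseteq> ask_trees V" and R: "finite R"
  obtains B :: "(nat, 'v, 'r) bprog" where
    "branching_program k V R B" "bp_size B \<le> c + card R"
    "A \<subseteq> det_trees V \<Longrightarrow> deterministic k B"
    "\<And>x p. activated_path B x p \<Longrightarrow> trace x t (map (bp_label B) p)"
    "\<And>x ls. x \<in> V \<rightarrow>\<^sub>E {1..k} \<Longrightarrow> trace x t ls \<Longrightarrow>
       \<exists>p. activated_path B x p \<and> map (bp_label B) p = ls"
proof -
  have "forest k {t} = subtrees k t" "forest k (Out ` R) = (Out ` R :: ('v, 'r) ptree set)"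
    by (auto simp: forest_def)
  then obtain N where N: "N \<subseteq> A" "finite N" "card N \<le> c" "subtrees k t \<subseteq> N \<union> Out ` R"
    using cov unfolding covers_def by metis
  \<comment> \<open>Every output needs its own final state, even one that no computation reaches, so
    all leaves are added; this is the summand \<open>card R\<close>.\<close>
  define S where "S = subtrees k t \<union> Out ` R"
  have S_sub: "S \<subseteq> N \<union> Out ` R"
    using N(4) by (auto simp: S_def)
  have fin: "finite S"
    using S_sub N(2) R by (meson finite_UnI finite_imageI finite_subset)
  have cardS: "card S \<le> c + card R"
  proof -
    have "card S \<le> card (N \<union> Out ` R)"
      using S_sub N(2) R by (intro card_mono) auto
    also have "\<dots> \<le> card N + card (Out ` R :: ('v, 'r) ptree set)" by (rule card_Un_le)
    also have "\<dots> \<le> c + card R" using N(3) card_image_le[OF R, of Out] by (intro add_mono) auto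
    finally show ?thesis .
  qed
  have tS: "t \<in> S" by (simp add: S_def subtree.self)
  have AskS: "Ask q \<kappa> \<in> A" if "Ask q \<kappa> \<in> S" for q \<kappa>
    using that S_sub N(1) by auto
  have AskV: "q \<in> V" if "Ask q \<kappa> \<in> S" for q \<kappa>
    using AskS[OF that] A by (auto simp: ask_trees_def)
  have closed: "s \<in> S" if "Ask q \<kappa> \<in> S" "a \<in> {1..k}" "s \<in> set (\<kappa> a)" for q \<kappa> a s
    using that subtree_closed[of k q \<kappa> t a s] by (auto simp: S_def)
  obtain f :: "('v, 'r) ptree \<Rightarrow> nat" where inj: "inj_on f S"
    using finite_imp_inj_to_nat_seg[OF fin] by auto
  define E where "E = {(f (Ask q \<kappa>), a, f s) | q \<kappa> a s. Ask q \<kappa> \<in> S \<and> a \<in> {1..k} \<and> s \<in> set (\<kappa> a)}"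
  have "E \<subseteq> f ` S \<times> {1..k} \<times> f ` S"
    using closed by (auto simp: E_def)
  then have finE: "finite E"
    using fin by (meson finite_SigmaI finite_atLeastAtMost finite_imageI finite_subset)
  define B where "B = \<lparr>bp_states = f ` S, bp_root = f t,
    bp_label = (\<lambda>s. ptree_label (the_inv_into S f s)), bp_edges = mset_set E\<rparr>"
  have label: "bp_label B (f s) = ptree_label s" if "s \<in> S" for s
    using that inj by (simp add: B_def the_inv_into_f_f)
  have act: "activated B x (f s) u \<longleftrightarrow>
      (\<exists>q \<kappa> s'. s = Ask q \<kappa> \<and> x q \<in> {1..k} \<and> s' \<in> set (\<kappa> (x q)) \<and> u = f s')"
    if s: "s \<in> S" for x s u
  proof
    assume "activated B x (f s) u"
    then obtain q where q: "ptree_label s = Query q" "(f s, x q, u) \<in> E"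
      using finE s by (auto simp: activated_def label) (simp add: B_def)
    then obtain q' \<kappa> s' where *: "f s = f (Ask q' \<kappa>)" "Ask q' \<kappa> \<in> S" "x q \<in> {1..k}"
        "s' \<in> set (\<kappa> (x q))" "u = f s'"
      by (auto simp: E_def)
    then have "s = Ask q' \<kappa>" using inj s by (meson inj_onD)
    with * q show "\<exists>q \<kappa> s'. s = Ask q \<kappa> \<and> x q \<in> {1..k} \<and> s' \<in> set (\<kappa> (x q)) \<and> u = f s'" by auto
  next
    assume "\<exists>q \<kappa> s'. s = Ask q \<kappa> \<and> x q \<in> {1..k} \<and> s' \<in> set (\<kappa> (x q)) \<and> u = f s'"
    then obtain q \<kappa> s' where *: "s = Ask q \<kappa>" "x q \<in> {1..k}" "s' \<in> set (\<kappa> (x q))" "u = f s'"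
      by auto
    then have "(f s, x q, u) \<in># bp_edges B"
      using finE s by (auto simp: B_def E_def)
    then show "activated B x (f s) u"
      using * label[OF s] by (auto simp: activated_def)
  qed
  have path1: "trace x s (map (bp_label B) p)"
    if "successively (activated B x) p" "p \<noteq> []" "hd p = f s" "s \<in> S" for x p s
    using that
  proof (induction p arbitrary: s)
    case (Cons u p)
    show ?case
    proof (cases p)
      case Nil
      then show ?thesis using Cons.prems label by (auto intro: trace.intros)
    next
      case (Cons u' p')
      then have "activated B x (f s) u'"
        using Cons.prems by simp
      then obtain q \<kappa> s' where *: "s = Ask q \<kappa>" "x q \<in> {1..k}" "s' \<in> set (\<kappa> (x q))" "u' = f s'"
        using act[OF Cons.prems(4)] by auto
      have "trace x s' (map (bp_label B) p)"
        using Cons.IH[of s'] Cons Cons.prems * closed by auto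
      then show ?thesis
        using * Cons.prems label[OF Cons.prems(4)] by (auto intro: trace.intros)
    qed
  qed auto
  \<comment> \<open>Unlike the converse \<open>path1\<close>, this direction needs \<open>x\<close>
    to be in range: a trace may follow any answer, but edges exist only for labels in
    \<open>{1..k}\<close>.\<close>
  have path2: "\<exists>p. successively (activated B x) p \<and> p \<noteq> [] \<and> hd p = f s \<and> map (bp_label B) p = ls"
    if "trace x s ls" "s \<in> S" and x: "x \<in> V \<rightarrow>\<^sub>E {1..k}" for x s ls
    using that(1,2)
  proof (induction rule: trace.induct)
    case (1 s)
    then show ?case using label by (intro exI[of _ "[f s]"]) auto
  next
    case (2 s' \<kappa> q ls)
    have xq: "x q \<in> {1..k}" using x AskV[OF 2(4)] by auto
    then obtain p where p: "successively (activated B x) p" "p \<noteq> []" "hd p = f s'"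
        "map (bp_label B) p = ls"
      using 2 closed by blast
    have "activated B x (f (Ask q \<kappa>)) (f s')"
      using act[OF 2(4)] xq 2(1) by auto
    then show ?case
      using p label[OF 2(4)] by (intro exI[of _ "f (Ask q \<kappa>) # p"]) (cases p, auto)
  qed
  have bp: "branching_program k V R B"
    unfolding branching_program_def
  proof (intro conjI ballI allI impI)
    show "finite (bp_states B)" "bp_root B \<in> bp_states B"
      using fin tS by (auto simp: B_def)
  next
    fix s q assume "s \<in> bp_states B" "bp_label B s = Query q"
    then obtain u where "u \<in> S" "ptree_label u = Query q"
      using label by (auto simp: B_def)
    then show "q \<in> V" using AskV by (cases u) auto
  next
    fix s r assume "s \<in> bp_states B" "bp_label B s = Final r"
    then obtain u where "u \<in> S" "ptree_label u = Final r"
      using label by (auto simp: B_def)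
    then show "r \<in> R" using S_sub N(1) A by (cases u) (auto simp: ask_trees_def)
  next
    fix r assume r: "r \<in> R"
    then have rS: "Out r \<in> S" by (auto simp: S_def)
    show "\<exists>!s. s \<in> bp_states B \<and> bp_label B s = Final r"
    proof (intro ex1I[of _ "f (Out r)"] conjI; (elim conjE)?)
      show "f (Out r) \<in> bp_states B" using rS by (auto simp: B_def)
      show "bp_label B (f (Out r)) = Final r" using label[OF rS] by simp
      fix s assume "s \<in> bp_states B" "bp_label B s = Final r"
      then obtain u where u: "u \<in> S" "ptree_label u = Final r" "s = f u"
        using label by (auto simp: B_def)
      then show "s = f (Out r)" by (cases u) auto
    qed
  next
    fix e assume "e \<in># bp_edges B"
    then have "e \<in> E" using finE by (simp add: B_def)
    then obtain q \<kappa> a s where e: "e = (f (Ask q \<kappa>), a, f s)" "Ask q \<kappa> \<in> S" "a \<in> {1..k}" "s \<in> set (\<kappa> a)"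
      unfolding E_def by blast
    moreover have "s \<in> S" using closed e by blast
    moreover have "\<not> final_state B (f (Ask q \<kappa>))"
      using label[OF e(2)] by (simp add: final_state_def)
    ultimately show "case e of (s, a, t) \<Rightarrow>
        s \<in> bp_states B \<and> \<not> final_state B s \<and> a \<in> {1..k} \<and> t \<in> bp_states B"
      by (simp add: B_def)
  qed
  have det: "deterministic k B" if Adet: "A \<subseteq> det_trees V"
    unfolding deterministic_def
  proof (intro ballI impI)
    fix u assume "u \<in> bp_states B" "\<not> final_state B u"
    then obtain s where s: "s \<in> S" "u = f s" "\<And>r. ptree_label s \<noteq> Final r"
      using label by (auto simp: B_def final_state_def)
    then obtain q \<kappa>' where "s = Ask q \<kappa>'" by (cases s) auto
    then obtain \<kappa> where sq: "s = Ask q (\<lambda>a. [\<kappa> a])"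
      using AskS[of q \<kappa>'] s(1) Adet by (auto simp: det_trees_def)
    \<comment> \<open>The triples differ in their label even when their targets agree, so projecting
      to labels yields every label exactly once.\<close>
    have "{e \<in> E. case e of (v, _, _) \<Rightarrow> v = u} = (\<lambda>a. (u, a, f (\<kappa> a))) ` {1..k}"
    proof (intro equalityI subsetI)
      fix e assume "e \<in> {e \<in> E. case e of (v, _, _) \<Rightarrow> v = u}"
      then obtain q' \<kappa>2 a s' where e: "e = (u, a, f s')" "u = f (Ask q' \<kappa>2)" "Ask q' \<kappa>2 \<in> S"
          "a \<in> {1..k}" "s' \<in> set (\<kappa>2 a)"
        by (auto simp: E_def)
      then have "s = Ask q' \<kappa>2" using inj s by (metis inj_onD)
      then show "e \<in> (\<lambda>a. (u, a, f (\<kappa> a))) ` {1..k}" using e sq by auto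
    next
      fix e assume "e \<in> (\<lambda>a. (u, a, f (\<kappa> a))) ` {1..k}"
      then show "e \<in> {e \<in> E. case e of (v, _, _) \<Rightarrow> v = u}"
        using s(1,2) sq unfolding E_def by fastforce
    qed
    then have "filter_mset (\<lambda>(v, _, _). v = u) (bp_edges B) = mset_set ((\<lambda>a. (u, a, f (\<kappa> a))) ` {1..k})"
      using finE by (simp add: B_def case_prod_beta)
    also have "\<dots> = image_mset (\<lambda>a. (u, a, f (\<kappa> a))) (mset_set {1..k})"
      by (rule image_mset_mset_set[symmetric]) (auto simp: inj_on_def)
    finally show "image_mset (\<lambda>(_, a, _). a) (filter_mset (\<lambda>(v, _, _). v = u) (bp_edges B)) = mset_set {1..k}"
      by (simp add: multiset.map_comp comp_def)
  qed
  have "bp_size B \<le> c + card R"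
    using cardS card_image[OF inj] by (simp add: bp_size_def B_def)
  moreover have "trace x t (map (bp_label B) p)" if "activated_path B x p" for x p
    using that path1[of x p t] tS by (auto simp: activated_path_def B_def)
  moreover have "\<exists>p. activated_path B x p \<and> map (bp_label B) p = ls"
    if x: "x \<in> V \<rightarrow>\<^sub>E {1..k}" and tr: "trace x t ls" for x ls
  proof -
    obtain p where "successively (activated B x) p" "p \<noteq> []" "hd p = f t" "map (bp_label B) p = ls"
      using path2[OF tr tS x] by blast
    then show ?thesis by (intro exI[of _ p]) (simp add: activated_path_def B_def)
  qed
  ultimately show thesis by (intro that[OF bp _ det])
qed

subsection \<open>Deterministic evaluation\<close>

lemma covers_Ask_det:
  assumes "q \<in> V"
  shows "covers k (det_trees V) 1 {Ask q (\<lambda>a. [\<kappa> a])} (\<kappa> ` {1..k})"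
proof -
  have "Ask q (\<lambda>a. [\<kappa> a]) \<in> det_trees V"
    using assms by (auto simp: det_trees_def)
  from covers_Ask[OF this, of k] show ?thesis
    by (rule covers_mono) auto
qed

text \<open>The run on \<open>x\<close> has no choices, ends in \<open>r\<close>, and makes only
  queries satisfying \<open>P\<close>. The predicate propagates backwards, from a continuation at
  the correct value to the program that calls it, which fits continuation-passing style.\<close>

inductive certain :: "('v \<Rightarrow> bool) \<Rightarrow> ('v \<Rightarrow> nat) \<Rightarrow> ('v, 'r) ptree \<Rightarrow> 'r \<Rightarrow> bool" for P x where
  "certain P x (Out r) r"
| "P q \<Longrightarrow> certain P x (\<kappa> (x q)) r \<Longrightarrow> certain P x (Ask q (\<lambda>a. [\<kappa> a])) r"

lemma certain_trace:
  assumes "certain P x t r" "trace x t ls"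
  shows "(\<forall>q. Query q \<in> set ls \<longrightarrow> P q) \<and> (\<forall>r'. last ls = Final r' \<longrightarrow> r' = r)"
  using assms
proof (induction arbitrary: ls rule: certain.induct)
  case (1 r)
  then show ?case by (auto elim: trace.cases)
next
  case (2 q \<kappa> r)
  note tr = 2(4)
  from tr show ?case
  proof cases
    case 1
    then show ?thesis using 2(1) by auto
  next
    case (2 t' ls')
    moreover have "ls' \<noteq> []" using 2 by (auto elim: trace.cases)
    ultimately show ?thesis using "2.IH" \<open>P q\<close> by auto
  qed
qed

lemma certain_ex_trace: "certain P x t r \<Longrightarrow> \<exists>ls. trace x t ls \<and> last ls = Final r"
proof (induction rule: certain.induct)
  case (1 r)
  then show ?case using trace.intros(1)[of x "Out r"] by fastforce
next
  case (2 q \<kappa> r)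
  then obtain ls where ls: "trace x (\<kappa> (x q)) ls" "last ls = Final r" by auto
  moreover have "ls \<noteq> []" using ls(1) by (auto elim: trace.cases)
  ultimately show ?case using trace.intros(2)[of "\<kappa> (x q)" "\<lambda>a. [\<kappa> a]" x q ls] by fastforce
qed

text \<open>\<open>E j\<close> is a subprogram for index \<open>j\<close> in continuation-passing
  style, and the length of \<open>acc\<close> serves as the next index. The same combinator collects
  values of siblings, the bits of a block, and high digits.\<close>

primrec gather :: "(nat \<Rightarrow> ('a \<Rightarrow> 't) \<Rightarrow> 't) \<Rightarrow> nat \<Rightarrow> 'a list \<Rightarrow> ('a list \<Rightarrow> 't) \<Rightarrow> 't" where
  "gather E 0 acc \<kappa> = \<kappa> acc"
| "gather E (Suc m) acc \<kappa> = E (length acc) (\<lambda>v. gather E m (acc @ [v]) \<kappa>)"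

lemma certain_gather:
  assumes "\<And>j \<kappa>. j < length acc + m \<Longrightarrow> certain P x (\<kappa> (f j)) r \<Longrightarrow> certain P x (E j \<kappa>) r"
    and "certain P x (\<kappa> (acc @ map f [length acc..<length acc + m])) r"
  shows "certain P x (gather E m acc \<kappa>) r"
  using assms
proof (induction m arbitrary: acc)
  case (Suc m)
  have "certain P x (gather E m (acc @ [f (length acc)]) \<kappa>) r"
    using Suc.prems(2) by (intro Suc.IH Suc.prems(1)) (simp_all add: upt_conv_Cons del: upt_Suc)
  then show ?case
    using Suc.prems(1)[of "length acc" "\<lambda>v. gather E m (acc @ [v]) \<kappa>"] by simp
qed simp

text \<open>There are \<open>m\<close> stages. A stage that already remembers \<open>l\<close>
  values occurs in at most \<open>w ^ l\<close> copies of cost \<open>c\<close>, and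
  \<open>l\<close> is at most \<open>m - 1\<close>.\<close>

lemma covers_gather:
  assumes E: "\<And>j \<kappa>. j < length acc + m \<Longrightarrow> covers k A c {E j \<kappa>} (\<kappa> ` W)"
    and W: "finite W" "card W \<le> w" "1 \<le> w"
  shows "covers k A (m * w ^ (m - 1) * c) {gather E m acc \<kappa>} ((\<lambda>b. \<kappa> (acc @ b)) ` {b. set b \<subseteq> W \<and> length b = m})"
  using E
proof (induction m arbitrary: acc)
  case 0
  have "{b. set b \<subseteq> W \<and> length b = 0} = {[]}" by auto
  then show ?case by (simp add: covers_subset)
next
  case (Suc m)
  let ?Y = "(\<lambda>b. \<kappa> (acc @ b)) ` {b. set b \<subseteq> W \<and> length b = Suc m}"
  have 1: "covers k A c {gather E (Suc m) acc \<kappa>} ((\<lambda>v. gather E m (acc @ [v]) \<kappa>) ` W)"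
    using Suc.prems[of "length acc" "\<lambda>v. gather E m (acc @ [v]) \<kappa>"] by simp
  have 2: "covers k A (w * (m * w ^ (m - 1) * c)) ((\<lambda>v. gather E m (acc @ [v]) \<kappa>) ` W) ?Y"
  proof (rule covers_image)
    fix v assume v: "v \<in> W"
    have "covers k A (m * w ^ (m - 1) * c) {gather E m (acc @ [v]) \<kappa>}
        ((\<lambda>b. \<kappa> ((acc @ [v]) @ b)) ` {b. set b \<subseteq> W \<and> length b = m})"
      using Suc.prems by (intro Suc.IH) auto
    then show "covers k A (m * w ^ (m - 1) * c) {gather E m (acc @ [v]) \<kappa>} ?Y"
      by (rule covers_mono) (use v in \<open>auto intro!: image_eqI[of _ _ "v # _"]\<close>)
  qed (use W in auto)
  \<comment> \<open>The case \<open>m = 0\<close> is separate because \<open>m - 1\<close> is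
    truncated there.\<close>
  have "c + w * (m * w ^ (m - 1) * c) \<le> Suc m * w ^ (Suc m - 1) * c"
  proof (cases m)
    case (Suc l)
    then show ?thesis using W(3) by (simp add: algebra_simps)
  qed simp
  with covers_trans[OF 1 2] show ?case by (rule covers_mono) auto
qed

section \<open>Depth-first evaluation of the tree\<close>

primrec eval_tree :: "nat \<Rightarrow> nat \<Rightarrow> node \<Rightarrow> (nat \<Rightarrow> (tree_var, 'r) ptree) \<Rightarrow> (tree_var, 'r) ptree" where
  "eval_tree d 0 i \<kappa> = Ask (LeafVal i) (\<lambda>v. [\<kappa> v])"
| "eval_tree d (Suc n) i \<kappa> =
     gather (\<lambda>j. eval_tree d n (i @ [j])) d [] (\<lambda>a. Ask (FunVal i a) (\<lambda>v. [\<kappa> v]))"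

definition thrifty_query :: "nat \<Rightarrow> nat \<Rightarrow> (tree_var \<Rightarrow> nat) \<Rightarrow> tree_var \<Rightarrow> bool" where
  "thrifty_query d h x q \<longleftrightarrow>
     (\<forall>i a. q = FunVal i a \<longrightarrow> a = map (\<lambda>j. node_value d h x (i @ [j])) [0..<d])"

lemma thrifty_queryI:
  "length i + Suc n + 1 = h \<Longrightarrow>
    thrifty_query d h x (FunVal i (map (\<lambda>j. value_above d x n (i @ [j])) [0..<d]))"
  by (auto simp: thrifty_query_def node_value_def)

text \<open>A function is queried only after all children have been evaluated correctly, hence
  thriftily. \<open>P\<close> may be any consequence of thriftiness, so the lemma serves both the
  thrifty program for \<open>FT\<close> and the program for \<open>BT\<close>, where
  \<open>P\<close> is trivial.\<close>

lemma certain_eval_tree: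
  assumes "\<And>q. thrifty_query d h x q \<Longrightarrow> P q" "length i + n + 1 = h"
    and "certain P x (\<kappa> (value_above d x n i)) r"
  shows "certain P x (eval_tree d n i \<kappa>) r"
  using assms(2,3)
proof (induction n arbitrary: i \<kappa>)
  case 0
  then show ?case by (auto intro!: certain.intros assms(1) simp: thrifty_query_def)
next
  case (Suc n)
  show ?case unfolding eval_tree.simps
  proof (rule certain_gather[where f = "\<lambda>j. value_above d x n (i @ [j])"])
    show "certain P x
        (Ask (FunVal i ([] @ map (\<lambda>j. value_above d x n (i @ [j])) [length []..<length [] + d])) (\<lambda>v. [\<kappa> v])) r"
      using Suc.prems thrifty_queryI[of i n h d x] by (auto intro!: certain.intros assms(1))
  qed (use Suc.IH Suc.prems in auto)
qed

lemma card_lists_le: "card {b. set b \<subseteq> {1..k::nat} \<and> length b = m} \<le> k ^ m"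
  using card_lists_length_eq[of "{1..k}" m] by simp

lemma FunVal_in_tree_vars:
  "set i \<subseteq> {..<d} \<Longrightarrow> Suc (length i) < h \<Longrightarrow> length a = d \<Longrightarrow> set a \<subseteq> {1..k} \<Longrightarrow> FunVal i a \<in> tree_vars d h k"
  by (auto simp: tree_vars_def internal_nodes_def)

lemma LeafVal_in_tree_vars:
  "set i \<subseteq> {..<d} \<Longrightarrow> Suc (length i) = h \<Longrightarrow> LeafVal i \<in> tree_vars d h k"
  by (auto simp: tree_vars_def leaves_def)

text \<open>While one child is evaluated, at most \<open>d - 1\<close> sibling values are
  remembered; each level thus contributes a factor \<open>k ^ (d - 1)\<close>, and the leaf query
  one more \<open>k\<close>. Passing up a level replaces \<open>C\<close> by
  \<open>d * C + 1\<close>: one term per child, and the \<open>k ^ d\<close> queries to the function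
  of the node. The constant is chosen before \<open>k\<close>, the node and the
  continuation.\<close>

lemma covers_eval_tree:
  assumes "d \<ge> 1"
  shows "\<exists>C. \<forall>k \<ge> 1. \<forall>i (\<kappa> :: nat \<Rightarrow> (tree_var, 'r) ptree). set i \<subseteq> {..<d} \<longrightarrow> length i + n + 1 = h \<longrightarrow>
    covers k (det_trees (tree_vars d h k)) (C * k ^ (n * (d - 1) + 1)) {eval_tree d n i \<kappa>} (\<kappa> ` {1..k})"
proof (induction n)
  case 0
  show ?case
  proof (intro exI[of _ 1] allI impI)
    fix k :: nat and i and \<kappa> :: "nat \<Rightarrow> (tree_var, 'r) ptree"
    assume *: "1 \<le> k" "set i \<subseteq> {..<d}" "length i + 0 + 1 = h"
    show "covers k (det_trees (tree_vars d h k)) (1 * k ^ (0 * (d - 1) + 1)) {eval_tree d 0 i \<kappa>} (\<kappa> ` {1..k})"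
      unfolding eval_tree.simps
      by (rule covers_mono[OF covers_Ask_det]) (use * LeafVal_in_tree_vars in auto)
  qed
next
  case (Suc n)
  then obtain C where C: "\<And>k i \<kappa>. 1 \<le> k \<Longrightarrow> set i \<subseteq> {..<d} \<Longrightarrow> length i + n + 1 = h \<Longrightarrow>
    covers k (det_trees (tree_vars d h k)) (C * k ^ (n * (d - 1) + 1))
      {eval_tree d n i (\<kappa> :: nat \<Rightarrow> (tree_var, 'r) ptree)} (\<kappa> ` {1..k})" by blast
  show ?case
  proof (intro exI[of _ "d * C + 1"] allI impI)
    fix k :: nat and i and \<kappa> :: "nat \<Rightarrow> (tree_var, 'r) ptree"
    assume *: "1 \<le> k" "set i \<subseteq> {..<d}" "length i + Suc n + 1 = h"
    let ?A = "det_trees (tree_vars d h k) :: (tree_var, 'r) ptree set"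
    let ?F = "\<lambda>a. Ask (FunVal i a) (\<lambda>v. [\<kappa> v])"
    let ?L = "{b. set b \<subseteq> {1..k} \<and> length b = d}"
    have 1: "covers k ?A (d * k ^ (d - 1) * (C * k ^ (n * (d - 1) + 1)))
        {gather (\<lambda>j. eval_tree d n (i @ [j])) d [] ?F} (?F ` ?L)"
      using covers_gather[of "[]" d k ?A "C * k ^ (n * (d - 1) + 1)" "\<lambda>j. eval_tree d n (i @ [j])" "{1..k}" k ?F]
        C * by auto
    have 2: "covers k ?A (k ^ d * 1) (?F ` ?L) (\<kappa> ` {1..k})"
      using * card_lists_le FunVal_in_tree_vars finite_lists_length_eq[of "{1..k}" d]
      by (intro covers_image covers_Ask_det) auto
    have "d * k ^ (d - 1) * (C * k ^ (n * (d - 1) + 1)) = d * C * k ^ (Suc n * (d - 1) + 1)"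
      by (simp add: power_add)
    moreover have "k ^ d * 1 \<le> k ^ (Suc n * (d - 1) + 1)"
      using *(1) assms by (simp add: power_increasing)
    ultimately show "covers k ?A ((d * C + 1) * k ^ (Suc n * (d - 1) + 1)) {eval_tree d (Suc n) i \<kappa>} (\<kappa> ` {1..k})"
      unfolding eval_tree.simps
      by (intro covers_mono[OF covers_trans[OF 1 2]]) (simp_all only: add_mult_distrib mult_1 add_mono order_refl)
  qed
qed

lemma value_above_in_range:
  assumes "x \<in> tree_vars d h k \<rightarrow>\<^sub>E {1..k}" "set i \<subseteq> {..<d}" "length i + n + 1 = h"
  shows "value_above d x n i \<in> {1..k}"
  using assms(2,3)
proof (induction n arbitrary: i)
  case 0
  then show ?case using LeafVal_in_tree_vars[of i d h k] assms(1) by (auto simp: PiE_iff)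
next
  case (Suc n)
  have "FunVal i (map (\<lambda>j. value_above d x n (i @ [j])) [0..<d]) \<in> tree_vars d h k"
    using Suc by (intro FunVal_in_tree_vars) force+
  then show ?case using assms(1) by (auto simp: PiE_iff)
qed

lemma computes_of_traces:
  assumes B: "\<And>x p. activated_path B x p \<Longrightarrow> trace x t (map (bp_label B) p)"
    "\<And>x ls. x \<in> V \<rightarrow>\<^sub>E {1..k} \<Longrightarrow> trace x t ls \<Longrightarrow> \<exists>p. activated_path B x p \<and> map (bp_label B) p = ls"
    and sound: "\<And>x ls r. x \<in> V \<rightarrow>\<^sub>E {1..k} \<Longrightarrow> trace x t ls \<Longrightarrow> last ls = Final r \<Longrightarrow> r = g x"
    and ex: "\<And>x. x \<in> V \<rightarrow>\<^sub>E {1..k} \<Longrightarrow> \<exists>ls. trace x t ls \<and> last ls = Final (g x)"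
  shows "computes k V B g"
proof (rule computesI)
  fix x p r assume x: "x \<in> V \<rightarrow>\<^sub>E {1..k}" and p: "activated_path B x p" "bp_label B (last p) = Final r"
  then have "last (map (bp_label B) p) = Final r" by (simp add: last_map activated_path_def)
  then show "r = g x" using sound[OF x B(1)[OF p(1)]] by simp
next
  fix x assume x: "x \<in> V \<rightarrow>\<^sub>E {1..k}"
  then obtain p where "activated_path B x p" "last (map (bp_label B) p) = Final (g x)"
    using ex[OF x] B(2)[OF x] by blast
  then show "\<exists>p. activated_path B x p \<and> bp_label B (last p) = Final (g x)"
    by (auto simp: last_map activated_path_def)
qed

lemma thrifty_at_iff: "thrifty_at d h B x s \<longleftrightarrow> (\<forall>q. bp_label B s = Query q \<longrightarrow> thrifty_query d h x q)"
  by (auto simp: thrifty_at_def thrifty_query_def)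

lemma det_FT_program:
  assumes "d \<ge> 2" "h \<ge> 2"
  shows "\<exists>C. \<forall>k \<ge> 1. \<exists>B. det_solves_FT d h k B \<and> det_thrifty d h k B \<and>
    bp_size B \<le> C * k ^ ((d - 1) * (h - 1) + 1)"
proof -
  obtain C where C: "\<And>k i \<kappa>. 1 \<le> k \<Longrightarrow> set i \<subseteq> {..<d} \<Longrightarrow> length i + (h - 1) + 1 = h \<Longrightarrow>
    covers k (det_trees (tree_vars d h k)) (C * k ^ ((h - 1) * (d - 1) + 1))
      {eval_tree d (h - 1) i (\<kappa> :: nat \<Rightarrow> (tree_var, nat) ptree)} (\<kappa> ` {1..k})"
    using covers_eval_tree[of d "h - 1" h] assms by auto
  have "\<exists>B. det_solves_FT d h k B \<and> det_thrifty d h k B \<and>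
    bp_size B \<le> (C + 1) * k ^ ((d - 1) * (h - 1) + 1)" if k: "k \<ge> 1" for k
  proof -
    let ?V = "tree_vars d h k"
    let ?t = "eval_tree d (h - 1) [] Out :: (tree_var, nat) ptree"
    have cov: "covers k (det_trees ?V) (C * k ^ ((h - 1) * (d - 1) + 1)) {?t} (Out ` {1..k})"
      using C[of k "[]" Out] k assms by simp
    obtain B :: "(nat, tree_var, nat) bprog" where B:
      "branching_program k ?V {1..k} B" "bp_size B \<le> C * k ^ ((h - 1) * (d - 1) + 1) + card {1..k}"
      "deterministic k B"
      "\<And>x p. activated_path B x p \<Longrightarrow> trace x ?t (map (bp_label B) p)"
      "\<And>x ls. x \<in> ?V \<rightarrow>\<^sub>E {1..k} \<Longrightarrow> trace x ?t ls \<Longrightarrow>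
         \<exists>p. activated_path B x p \<and> map (bp_label B) p = ls"
      by (rule program_of_ptree[OF cov det_trees_subset]) auto
    have cert: "certain (thrifty_query d h x) x ?t (FT d h x)" for x
      using assms by (intro certain_eval_tree) (auto simp: FT_def node_value_def intro: certain.intros)
    have "computes k ?V B (FT d h)"
      using certain_trace[OF cert] certain_ex_trace[OF cert]
      by (intro computes_of_traces[OF B(4,5)]) auto
    moreover have "det_thrifty d h k B"
      unfolding det_thrifty_def thrifty_at_iff
    proof (intro ballI allI impI)
      fix x p s q assume "activated_path B x p" "s \<in> set p" "bp_label B s = Query q"
      then show "thrifty_query d h x q"
        using certain_trace[OF cert B(4), of x p] by force
    qed
    moreover have "bp_size B \<le> (C + 1) * k ^ ((d - 1) * (h - 1) + 1)"
    proof -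
      \<comment> \<open>This absorbs the \<open>k\<close> final states into the bound.\<close>
      have "k \<le> k ^ ((h - 1) * (d - 1) + 1)"
        using k by (intro self_le_power) auto
      then have "bp_size B \<le> (C + 1) * k ^ ((h - 1) * (d - 1) + 1)"
        using B(2) unfolding add_mult_distrib card_atLeastAtMost mult_1 diff_Suc_1 by linarith
      then show ?thesis by (simp only: mult.commute)
    qed
    ultimately show ?thesis
      using B(1,3) by (intro exI[of _ B]) (simp add: det_solves_FT_def)
  qed
  then show ?thesis by blast
qed

subsection \<open>Saving a logarithmic factor for the decision problem\<close>

text \<open>The clamping only affects queries that the last block may make outside \<open>{1..k}\<close>.\<close>

definition learn_bits :: "nat \<Rightarrow> nat \<Rightarrow> nat \<Rightarrow> nat list \<Rightarrow> (nat list \<Rightarrow> (tree_var, 'r) ptree) \<Rightarrow> (tree_var, 'r) ptree" where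
  "learn_bits k b m S = gather (\<lambda>l \<kappa>. Ask (FunVal [] (S @ [max 1 (min k (m * b + l))]))
     (\<lambda>w. [\<kappa> (if w = 1 then 1 else 0)])) b []"

text \<open>What is forgotten determines the size: the first evaluation passes on only
  \<open>v div b\<close>, and the last continuation depends only on \<open>bits\<close>, neither on
  the block nor on \<open>S\<close>.\<close>

definition BT_tree :: "nat \<Rightarrow> nat \<Rightarrow> nat \<Rightarrow> nat \<Rightarrow> (tree_var, bool) ptree" where
  "BT_tree d n k b = eval_tree d n [d - 1] (\<lambda>v.
     gather (\<lambda>l. eval_tree d n [l]) (d - 1) [] (\<lambda>S.
     learn_bits k b (v div b) S (\<lambda>bits.
     eval_tree d n [d - 1] (\<lambda>v. Out (bits ! (v mod b) = 1)))))"

lemma certain_BT_tree: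
  assumes x: "x \<in> tree_vars d h k \<rightarrow>\<^sub>E {1..k}" and "d \<ge> 1" "h = Suc (Suc n)" "b \<ge> 1"
  shows "certain (\<lambda>_. True) x (BT_tree d n k b) (BT d h x)"
proof -
  define val where "val j = value_above d x n [j]" for j
  define v where "v = val (d - 1)"
  define S where "S = map val [0..<d - 1]"
  define bit :: "nat \<Rightarrow> nat" where
    "bit l = (if x (FunVal [] (S @ [max 1 (min k ((v div b) * b + l))])) = 1 then 1 else 0)" for l
  have "v \<in> {1..k}"
    unfolding v_def val_def using value_above_in_range[OF x, of "[d - 1]" n] assms by auto
  \<comment> \<open>At the one position that is finally read, the clamp changes nothing, because the
    correct value lies in \<open>{1..k}\<close>. Bits read through a changed index are never
    consulted.\<close>
  then have clamp: "max 1 (min k ((v div b) * b + v mod b)) = v"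
    by auto
  have "S @ [v] = map val [0..<d]"
    using \<open>d \<ge> 1\<close> by (cases d) (auto simp: S_def v_def)
  then have "BT d h x \<longleftrightarrow> x (FunVal [] (S @ [v])) = 1"
    using assms(3) by (simp add: BT_def node_value_def val_def[abs_def])
  then have BT: "BT d h x \<longleftrightarrow> map bit [0..<b] ! (v mod b) = 1"
    using \<open>b \<ge> 1\<close> clamp by (simp add: bit_def)
  have eval: "certain (\<lambda>_. True) x (eval_tree d n [j] \<kappa>) r"
    if "certain (\<lambda>_. True) x (\<kappa> (val j)) r" for j \<kappa> and r :: bool
    using that assms(3) unfolding val_def by (intro certain_eval_tree[where h = h]) auto
  have "certain (\<lambda>_. True) x (eval_tree d n [d - 1]
      (\<lambda>v. Out (map bit [0..<b] ! (v mod b) = 1))) (BT d h x)"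
    unfolding BT using certain.intros(1) by (intro eval) (simp add: v_def)
  then have "certain (\<lambda>_. True) x (learn_bits k b (v div b) S (\<lambda>bits.
      eval_tree d n [d - 1] (\<lambda>v. Out (bits ! (v mod b) = 1)))) (BT d h x)"
    unfolding learn_bits_def
    by (intro certain_gather[where f = bit] certain.intros(2)) (auto simp: bit_def)
  then have "certain (\<lambda>_. True) x (gather (\<lambda>l. eval_tree d n [l]) (d - 1) [] (\<lambda>S.
      learn_bits k b (v div b) S (\<lambda>bits.
      eval_tree d n [d - 1] (\<lambda>v. Out (bits ! (v mod b) = 1))))) (BT d h x)"
    by (intro certain_gather[where f = val] eval) (auto simp: S_def)
  then show ?thesis
    unfolding BT_tree_def v_def by (rule eval)
qed

lemma covers_learn_bits:
  assumes "length S = d - 1" "set S \<subseteq> {1..k}" "k \<ge> 1" "d \<ge> 1" "h \<ge> 2"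
  shows "covers k (det_trees (tree_vars d h k)) (b * 2 ^ (b - 1)) {learn_bits k b m S \<kappa>}
    (\<kappa> ` {c. set c \<subseteq> {0, 1} \<and> length c = b})"
proof -
  let ?A = "det_trees (tree_vars d h k)"
  let ?E = "\<lambda>l \<kappa>. Ask (FunVal [] (S @ [max 1 (min k (m * b + l))])) (\<lambda>w. [\<kappa> (if w = 1 then 1 else 0)])"
  have "covers k ?A 1 {?E l \<kappa>} (\<kappa> ` {0, 1})" for l and \<kappa> :: "nat \<Rightarrow> (tree_var, 'a) ptree"
    by (rule covers_mono[OF covers_Ask_det]) (use assms FunVal_in_tree_vars in auto)
  then show ?thesis
    unfolding learn_bits_def using covers_gather[of "[]" b k ?A 1 ?E "{0, 1}" 2 \<kappa>] by simp
qed

text \<open>The summands are the first evaluation of the last child, then for each block the other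
  children and the learning of bits for each tuple \<open>S\<close>, and finally one evaluation for
  each bit vector.\<close>

lemma covers_BT_tree:
  assumes d: "d \<ge> 2" and h: "h = Suc (Suc n)" and k: "k \<ge> 1" and b: "b \<ge> 1"
    and C: "\<And>i \<kappa>. set i \<subseteq> {..<d} \<Longrightarrow> length i + n + 1 = h \<Longrightarrow>
      covers k (det_trees (tree_vars d h k)) c {eval_tree d n i (\<kappa> :: nat \<Rightarrow> (tree_var, bool) ptree)} (\<kappa> ` {1..k})"
  shows "covers k (det_trees (tree_vars d h k))
    (c + (k div b + 1) * ((d - 1) * k ^ (d - 2) * c + k ^ (d - 1) * (b * 2 ^ (b - 1))) + 2 ^ b * c)
    {BT_tree d n k b} (range Out)"
proof -
  let ?A = "det_trees (tree_vars d h k) :: (tree_var, bool) ptree set"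
  define last where "last bits = eval_tree d n [d - 1] (\<lambda>v. Out (bits ! (v mod b) = (1::nat)))" for bits
  define learn where "learn m S = learn_bits k b m S last" for m S
  define others where "others m = gather (\<lambda>l. eval_tree d n [l]) (d - 1) [] (learn m)" for m
  define Bits where "Bits = {c. set c \<subseteq> {0, 1::nat} \<and> length c = b}"
  define Ss where "Ss = {S. set S \<subseteq> {1..k} \<and> length S = d - 1}"
  have eval: "covers k ?A c {eval_tree d n [j] \<kappa>} (\<kappa> ` {1..k})" if "j < d" for j \<kappa>
    using C[of "[j]" \<kappa>] that h by simp
  have 1: "covers k ?A c {BT_tree d n k b} (others ` {..k div b})"
  proof -
    have "covers k ?A c {eval_tree d n [d - 1] (\<lambda>v. others (v div b))} ((\<lambda>v. others (v div b)) ` {1..k})"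
      using d by (intro eval) auto
    then have "covers k ?A c {eval_tree d n [d - 1] (\<lambda>v. others (v div b))} (others ` {..k div b})"
      by (rule covers_mono) (auto intro!: imageI div_le_mono)
    then show ?thesis
      by (simp add: BT_tree_def others_def learn_def[abs_def] last_def[abs_def])
  qed
  \<comment> \<open>The target set is common to all blocks and all tuples, so the last evaluation is
    multiplied only by \<open>2 ^ b\<close>.\<close>
  have 2: "covers k ?A ((k div b + 1) * ((d - 1) * k ^ (d - 2) * c + k ^ (d - 1) * (b * 2 ^ (b - 1))))
      (others ` {..k div b}) (last ` Bits)"
  proof (rule covers_image)
    fix m
    have "covers k ?A ((d - 1) * k ^ (d - 1 - 1) * c) {others m} ((\<lambda>S. learn m ([] @ S)) ` Ss)"
      unfolding others_def Ss_def using k by (intro covers_gather eval) auto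
    moreover have "covers k ?A (k ^ (d - 1) * (b * 2 ^ (b - 1))) (learn m ` Ss) (last ` Bits)"
      unfolding learn_def
    proof (rule covers_image)
      show "finite Ss" "card Ss \<le> k ^ (d - 1)"
        unfolding Ss_def by (rule finite_lists_length_eq, simp, rule card_lists_le)
      fix S assume "S \<in> Ss"
      then show "covers k ?A (b * 2 ^ (b - 1)) {learn_bits k b m S last} (last ` Bits)"
        unfolding Bits_def by (intro covers_learn_bits) (use d h k Ss_def in auto)
    qed
    ultimately show "covers k ?A ((d - 1) * k ^ (d - 2) * c + k ^ (d - 1) * (b * 2 ^ (b - 1)))
        {others m} (last ` Bits)"
      using covers_trans by (simp add: numeral_2_eq_2) blast
  qed auto
  have 3: "covers k ?A (2 ^ b * c) (last ` Bits) (range Out)"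
  proof (rule covers_image)
    show "finite Bits" "card Bits \<le> 2 ^ b"
      using finite_lists_length_eq[of "{0, 1::nat}" b] card_lists_length_eq[of "{0, 1::nat}" b]
      by (auto simp: Bits_def numeral_2_eq_2)
    fix bits
    show "covers k ?A c {last bits} (range Out)"
      unfolding last_def by (rule covers_mono[OF eval]) (use d in auto)
  qed
  show ?thesis
    by (rule covers_trans[OF covers_trans[OF 1 2] 3])
qed

text \<open>The leading term is about \<open>k / b\<close> blocks times
  \<open>k ^ (d - 2) * c\<close>, which is of order \<open>k ^ M / b\<close>; all other terms stay
  within this order when \<open>b\<close> is logarithmic. Stating the bound for \<open>b\<close>
  times the size avoids division of naturals.\<close>

lemma det_BT_program:
  assumes d: "d \<ge> 2" and h: "h \<ge> 3"
  shows "\<exists>K. \<forall>k b. 1 \<le> b \<longrightarrow> 4 ^ b \<le> k \<longrightarrow> (\<exists>B. det_solves_BT d h k B \<and>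
    b * bp_size B \<le> K * k ^ ((d - 1) * (h - 1) + 1))"
proof -
  define n where "n = h - 2"
  have hn: "h = Suc (Suc n)" using h by (simp add: n_def)
  obtain C where C: "\<And>k i \<kappa>. 1 \<le> k \<Longrightarrow> set i \<subseteq> {..<d} \<Longrightarrow> length i + n + 1 = h \<Longrightarrow>
    covers k (det_trees (tree_vars d h k)) (C * k ^ (n * (d - 1) + 1))
      {eval_tree d n i (\<kappa> :: nat \<Rightarrow> (tree_var, bool) ptree)} (\<kappa> ` {1..k})"
    using covers_eval_tree[of d n h] d by auto
  define M where "M = (d - 1) * (h - 1) + 1"
  have "\<exists>B. det_solves_BT d h k B \<and> b * bp_size B \<le> (2 * C + 2 * (d - 1) * C + 4) * k ^ M"
    if b: "1 \<le> b" and bk: "4 ^ b \<le> k" for k b :: nat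
  proof -
    let ?V = "tree_vars d h k"
    define c where "c = C * k ^ (n * (d - 1) + 1)"
    have k: "k \<ge> 1" using bk order_trans[of 1 "4 ^ b" k] by simp
    have cov: "covers k (det_trees ?V)
      (c + (k div b + 1) * ((d - 1) * k ^ (d - 2) * c + k ^ (d - 1) * (b * 2 ^ (b - 1))) + 2 ^ b * c)
      {BT_tree d n k b} (Out ` UNIV)"
      unfolding c_def by (rule covers_BT_tree[OF d hn k b C[OF k]])
    obtain B :: "(nat, tree_var, bool) bprog" where B:
      "branching_program k ?V UNIV B"
      "bp_size B \<le> c + (k div b + 1) * ((d - 1) * k ^ (d - 2) * c + k ^ (d - 1) * (b * 2 ^ (b - 1)))
         + 2 ^ b * c + card (UNIV :: bool set)"
      "deterministic k B"
      "\<And>x p. activated_path B x p \<Longrightarrow> trace x (BT_tree d n k b) (map (bp_label B) p)"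
      "\<And>x ls. x \<in> ?V \<rightarrow>\<^sub>E {1..k} \<Longrightarrow> trace x (BT_tree d n k b) ls \<Longrightarrow>
         \<exists>p. activated_path B x p \<and> map (bp_label B) p = ls"
      by (rule program_of_ptree[OF cov det_trees_subset]) auto
    have cert: "certain (\<lambda>_. True) x (BT_tree d n k b) (BT d h x)" if "x \<in> ?V \<rightarrow>\<^sub>E {1..k}" for x
      using certain_BT_tree[OF that] d hn b by auto
    have "computes k ?V B (BT d h)"
      using certain_trace[OF cert] certain_ex_trace[OF cert]
      by (intro computes_of_traces[OF B(4,5)]) auto
    then have "det_solves_BT d h k B"
      using B(1,3) by (simp add: det_solves_BT_def ndet_solves_BT_def)
    moreover have "b * bp_size B \<le> (2 * C + 2 * (d - 1) * C + 4) * k ^ M"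
    proof -
      \<comment> \<open>The condition \<open>4 ^ b \<le> k\<close> says
        \<open>s * s \<le> k\<close>. Together with \<open>b \<le> s\<close> it bounds
        \<open>b\<close>, \<open>b * 2 ^ b\<close> and \<open>b * 2 ^ (b - 1)\<close> by
        \<open>k\<close>.\<close>
      define s :: nat where "s = 2 ^ b"
      have ss: "s * s \<le> k"
        using bk by (simp add: s_def power_mult_distrib[symmetric])
      have bs: "b \<le> s" by (simp add: s_def less_imp_le)
      have bk': "b \<le> k" using bs ss by (meson le_square order_trans)
      have half: "2 ^ (b - 1) \<le> s" by (simp add: s_def)
      have "M = n * (d - 1) + 1 + (d - 1)"
        using d by (cases d) (auto simp: M_def hn)
      then have kc: "k ^ (d - 1) * c = C * k ^ M"
        by (simp add: c_def power_add)
      have kc': "k * c \<le> C * k ^ M"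
        unfolding kc[symmetric] using self_le_power[of k "d - 1"] k d by simp
      \<comment> \<open>Here three levels are needed: learning the bits costs order
        \<open>k ^ (d + 1) / b\<close>, whereas \<open>M\<close> would be only \<open>d\<close> for
        two levels.\<close>
      have "d + 1 \<le> M"
      proof -
        have "(d - 1) * 2 \<le> (d - 1) * (h - 1)" using h by (intro mult_le_mono2) auto
        moreover have "d \<le> (d - 1) * 2" using d by simp
        ultimately show ?thesis unfolding M_def by linarith
      qed
      then have kd: "k ^ (d + 1) \<le> k ^ M" using k by (intro power_increasing) auto
      have t1: "b * c \<le> C * k ^ M"
        using kc' mult_le_mono1[OF bk', of c] by linarith
      have bdiv: "b * (k div b + 1) \<le> 2 * k"
        using bk' by (simp add: algebra_simps) (metis add_mono mult.commute mult_2 times_div_less_eq_dividend)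
      have t2: "b * (k div b + 1) * ((d - 1) * k ^ (d - 2) * c) \<le> 2 * (d - 1) * C * k ^ M"
      proof -
        have "b * (k div b + 1) * ((d - 1) * k ^ (d - 2) * c) \<le> 2 * k * ((d - 1) * k ^ (d - 2) * c)"
          by (rule mult_le_mono1[OF bdiv])
        also have "\<dots> = 2 * (d - 1) * (k ^ Suc (d - 2) * c)" by simp
        also have "Suc (d - 2) = d - 1" using d by simp
        finally show ?thesis unfolding kc by simp
      qed
      have t3: "b * (k div b + 1) * (k ^ (d - 1) * (b * 2 ^ (b - 1))) \<le> 2 * k ^ M"
      proof -
        have "b * 2 ^ (b - 1) \<le> k"
          using mult_le_mono[OF bs half] ss by linarith
        then have "b * (k div b + 1) * (k ^ (d - 1) * (b * 2 ^ (b - 1))) \<le> 2 * k * (k ^ (d - 1) * k)"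
          by (intro mult_le_mono[OF bdiv] mult_le_mono2)
        also have "\<dots> = 2 * k ^ (d + 1)" using d by (cases d) auto
        finally show ?thesis using kd by linarith
      qed
      have t4: "b * (2 ^ b * c) \<le> C * k ^ M"
      proof -
        have "b * (2 ^ b * c) = (b * s) * c" by (simp add: s_def)
        also have "\<dots> \<le> k * c"
          using mult_le_mono1[OF bs, of s] ss by (intro mult_le_mono1) linarith
        finally show ?thesis using kc' by linarith
      qed
      have t5: "b * card (UNIV :: bool set) \<le> 2 * k ^ M"
      proof -
        have "k \<le> k ^ M" using k by (intro self_le_power) (auto simp: M_def)
        then show ?thesis using bk' by (simp add: card_UNIV_bool)
      qed
      have "b * bp_size B \<le> b * (c + (k div b + 1) * ((d - 1) * k ^ (d - 2) * c + k ^ (d - 1) * (b * 2 ^ (b - 1)))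
         + 2 ^ b * c + card (UNIV :: bool set))"
        using B(2) by (rule mult_le_mono2)
      also have "\<dots> = b * c + b * (k div b + 1) * ((d - 1) * k ^ (d - 2) * c)
          + b * (k div b + 1) * (k ^ (d - 1) * (b * 2 ^ (b - 1))) + b * (2 ^ b * c) + b * card (UNIV :: bool set)"
        by (simp only: distrib_left distrib_right mult.assoc add.assoc)
      also have "\<dots> \<le> C * k ^ M + 2 * (d - 1) * C * k ^ M + 2 * k ^ M + C * k ^ M + 2 * k ^ M"
        using t1 t2 t3 t4 t5 by (intro add_mono)
      also have "\<dots> = (2 * C + 2 * (d - 1) * C + 4) * k ^ M"
        by (simp add: algebra_simps)
      finally show ?thesis .
    qed
    ultimately show ?thesis by blast
  qed
  then show ?thesis unfolding M_def by blast
qed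

subsection \<open>Nondeterministic evaluation with half values\<close>

text \<open>The Boolean records whether all queries of the run satisfy \<open>P\<close>.\<close>

inductive run :: "('v \<Rightarrow> bool) \<Rightarrow> ('v \<Rightarrow> nat) \<Rightarrow> ('v, 'r) ptree \<Rightarrow> bool \<Rightarrow> 'r \<Rightarrow> bool" for P x where
  run_Out: "run P x (Out r) True r"
| run_Ask: "t \<in> set (\<kappa> (x q)) \<Longrightarrow> run P x t b r \<Longrightarrow> run P x (Ask q \<kappa>) (P q \<and> b) r"

inductive_cases run_OutE: "run P x (Out r') b r"
inductive_cases run_AskE: "run P x (Ask q \<kappa>) b r"

text \<open>Aborted computations yield no run. This matches nondeterministic thriftiness, which
  constrains only computations ending in a final state.\<close>

lemma run_of_trace:
  assumes "trace x t ls" "last ls = Final r"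
  shows "\<exists>b. run P x t b r \<and> (b \<longrightarrow> (\<forall>q. Query q \<in> set ls \<longrightarrow> P q))"
  using assms
proof (induction rule: trace.induct)
  case (1 t)
  then show ?case by (cases t) (auto intro: run_Out)
next
  case (2 t \<kappa> q ls)
  have "ls \<noteq> []" using 2(2) by (auto elim: trace.cases)
  then obtain b where "run P x t b r" "b \<longrightarrow> (\<forall>q. Query q \<in> set ls \<longrightarrow> P q)"
    using 2 by auto
  then show ?case using run_Ask[of t \<kappa> x q P b r] 2(1) by auto
qed

lemma trace_of_run: "run P x t b r \<Longrightarrow> \<exists>ls. trace x t ls \<and> last ls = Final r"
proof (induction rule: run.induct)
  case (run_Out r)
  then show ?case using trace.intros(1)[of x "Out r"] by fastforce
next
  case (run_Ask t \<kappa> q b r)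
  then obtain ls where ls: "trace x t ls" "last ls = Final r" by auto
  moreover have "ls \<noteq> []" using ls(1) by (auto elim: trace.cases)
  ultimately show ?case using trace.intros(2)[of t \<kappa> x q ls] run_Ask(1) by fastforce
qed

text \<open>
  A guessing subprogram passes to its continuation the claimed value and a function \<open>resume\<close>; the
  claim is justified only after the caller has run \<open>resume \<gamma>\<close>, which performs the pending checks
  and goes on with \<open>\<gamma>\<close>.
\<close>

type_synonym ('v, 'r) cont = "nat \<Rightarrow> (('v, 'r) ptree \<Rightarrow> ('v, 'r) ptree) \<Rightarrow> ('v, 'r) ptree list"

text \<open>The flag \<open>b1\<close> stands for the queries whose thriftiness still depends on the
  claim, \<open>b2\<close> for the rest of the run. Since \<open>b1\<close> is obtained only from a
  completed run of \<open>resume \<gamma>\<close>, a query made on guessed arguments may be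
  vindicated later.\<close>

definition sound_guess ::
  "('v \<Rightarrow> bool) \<Rightarrow> ('v \<Rightarrow> nat) \<Rightarrow> (('v, 'r) cont \<Rightarrow> ('v, 'r) ptree) \<Rightarrow> nat \<Rightarrow> bool" where
  "sound_guess P x E u \<longleftrightarrow> (\<forall>\<kappa> b r. run P x (E \<kappa>) b r \<longrightarrow>
     (\<exists>v resume t b1 b2. t \<in> set (\<kappa> v resume) \<and> run P x t b2 r \<and> (b1 \<and> b2 \<longrightarrow> b) \<and>
        (\<forall>\<gamma> b' r'. run P x (resume \<gamma>) b' r' \<longrightarrow>
           v = u \<and> b1 \<and> (\<exists>b''. (b'' \<longrightarrow> b') \<and> run P x \<gamma> b'' r'))))"

text \<open>A single \<open>resume\<close> must work for every caller, since it encodes only the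
  correct guesses for \<open>x\<close>. The flags are unconstrained: thriftiness is entirely a
  matter of soundness.\<close>

definition complete_guess ::
  "('v \<Rightarrow> bool) \<Rightarrow> ('v \<Rightarrow> nat) \<Rightarrow> (('v, 'r) cont \<Rightarrow> ('v, 'r) ptree) \<Rightarrow> nat \<Rightarrow> bool" where
  "complete_guess P x E u \<longleftrightarrow> (\<exists>resume.
     (\<forall>\<gamma> r. (\<exists>b. run P x \<gamma> b r) \<longrightarrow> (\<exists>b. run P x (resume \<gamma>) b r)) \<and>
     (\<forall>\<kappa> t r. t \<in> set (\<kappa> u resume) \<longrightarrow> (\<exists>b. run P x t b r) \<longrightarrow> (\<exists>b. run P x (E \<kappa>) b r)))"

text \<open>Resuming immediately turns a guess into an ordinary evaluation: whatever passes the
  pending checks was the true value. This is how high digits are collected, low digits are verified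
  and the root is finished.\<close>

lemma sound_guess_test:
  assumes "sound_guess P x E u"
    and "run P x (E (\<lambda>v resume. if T v then [resume (F v)] else [])) b r"
  shows "T u \<and> (\<exists>b'. (b' \<longrightarrow> b) \<and> run P x (F u) b' r)"
proof -
  obtain v resume t b1 b2 where *: "t \<in> set (if T v then [resume (F v)] else [])" "run P x t b2 r" "b1 \<and> b2 \<longrightarrow> b"
    and res: "\<And>\<gamma> b' r'. run P x (resume \<gamma>) b' r' \<Longrightarrow> v = u \<and> b1 \<and> (\<exists>b''. (b'' \<longrightarrow> b') \<and> run P x \<gamma> b'' r')"
    using assms(1)[unfolded sound_guess_def, rule_format, OF assms(2)] by (elim exE conjE) metis
  then have "T v" "t = resume (F v)" by (auto split: if_splits)
  with res[of "F v" b2 r] * show ?thesis by auto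
qed

lemma complete_guess_test:
  assumes "complete_guess P x E u" "T u" "\<exists>b. run P x (F u) b r"
  shows "\<exists>b. run P x (E (\<lambda>v resume. if T v then [resume (F v)] else [])) b r"
  using assms unfolding complete_guess_def by fastforce

section \<open>Gathering high digits and verifying low digits\<close>

lemma sound_gather:
  assumes "\<And>j \<kappa> b. j < length acc + m \<Longrightarrow> run P x (E j \<kappa>) b r \<Longrightarrow> \<exists>b'. (b' \<longrightarrow> b) \<and> run P x (\<kappa> (f j)) b' r"
    and "run P x (gather E m acc \<kappa>) b r"
  shows "\<exists>b'. (b' \<longrightarrow> b) \<and> run P x (\<kappa> (acc @ map f [length acc..<length acc + m])) b' r"
  using assms
proof (induction m arbitrary: acc b)
  case (Suc m)
  obtain b1 where b1: "b1 \<longrightarrow> b" "run P x (gather E m (acc @ [f (length acc)]) \<kappa>) b1 r"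
    using Suc.prems(1)[of "length acc" "\<lambda>v. gather E m (acc @ [v]) \<kappa>" b] Suc.prems(2) by auto
  have "\<exists>b2. (b2 \<longrightarrow> b1) \<and> run P x (\<kappa> ((acc @ [f (length acc)]) @
      map f [length (acc @ [f (length acc)])..<length (acc @ [f (length acc)]) + m])) b2 r"
    by (rule Suc.IH[OF _ b1(2)], rule Suc.prems(1)) auto
  then show ?case using b1(1) by (auto simp: upt_conv_Cons simp del: upt_Suc)
qed auto

lemma complete_gather:
  assumes "\<And>j \<kappa>. j < length acc + m \<Longrightarrow> \<exists>b. run P x (\<kappa> (f j)) b r \<Longrightarrow> \<exists>b. run P x (E j \<kappa>) b r"
    and "\<exists>b. run P x (\<kappa> (acc @ map f [length acc..<length acc + m])) b r"
  shows "\<exists>b. run P x (gather E m acc \<kappa>) b r"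
  using assms
proof (induction m arbitrary: acc)
  case (Suc m)
  have "\<exists>b. run P x (gather E m (acc @ [f (length acc)]) \<kappa>) b r"
    using Suc.prems(2) by (intro Suc.IH Suc.prems(1)) (simp_all add: upt_conv_Cons del: upt_Suc)
  then show ?case
    using Suc.prems(1)[of "length acc" "\<lambda>v. gather E m (acc @ [v]) \<kappa>"] by simp
qed simp

primrec verify :: "(nat \<Rightarrow> ('v, 'r) cont \<Rightarrow> ('v, 'r) ptree) \<Rightarrow> nat \<Rightarrow> nat list \<Rightarrow> nat \<Rightarrow> ('v, 'r) ptree \<Rightarrow> ('v, 'r) ptree" where
  "verify E q [] j \<gamma> = \<gamma>"
| "verify E q (l # ls) j \<gamma> =
     E j (\<lambda>v resume. if v mod q = l then [resume (verify E q ls (Suc j) \<gamma>)] else [])"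

lemma sound_verify:
  assumes "\<And>j. j < m \<Longrightarrow> sound_guess P x (E j) (u j)" "j + length ls = m"
    and "run P x (verify E q ls j \<gamma>) b r"
  shows "ls = map (\<lambda>l. u l mod q) [j..<m] \<and> (\<exists>b'. (b' \<longrightarrow> b) \<and> run P x \<gamma> b' r)"
  using assms(2,3)
proof (induction ls arbitrary: j b)
  case (Cons l ls)
  then have "j < m" by simp
  have "u j mod q = l \<and> (\<exists>b'. (b' \<longrightarrow> b) \<and> run P x (verify E q ls (Suc j) \<gamma>) b' r)"
    using Cons.prems(2) unfolding verify.simps
    by (rule sound_guess_test[OF assms(1)[OF \<open>j < m\<close>], of "\<lambda>v. v mod q = l"])
  then obtain b1 where b1: "u j mod q = l" "b1 \<longrightarrow> b" "run P x (verify E q ls (Suc j) \<gamma>) b1 r" by blast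
  with Cons.IH[OF _ b1(3)] Cons.prems(1) show ?case
    by (auto simp: upt_conv_Cons[OF \<open>j < m\<close>])
qed auto

lemma complete_verify:
  assumes "\<And>j. j < m \<Longrightarrow> complete_guess P x (E j) (u j)" "j \<le> m" "\<exists>b. run P x \<gamma> b r"
  shows "\<exists>b. run P x (verify E q (map (\<lambda>l. u l mod q) [j..<m]) j \<gamma>) b r"
  using assms(2)
proof (induction "m - j" arbitrary: j)
  case 0
  then show ?case using assms(3) by simp
next
  case (Suc n)
  then have "j < m" by simp
  then have "\<exists>b. run P x (verify E q (map (\<lambda>l. u l mod q) [Suc j..<m]) (Suc j) \<gamma>) b r"
    using Suc.hyps by (intro Suc.hyps(1)) auto
  with complete_guess_test[OF assms(1)[OF \<open>j < m\<close>], of "\<lambda>v. v mod q = u j mod q"]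
  show ?case by (simp add: upt_conv_Cons[OF \<open>j < m\<close>] del: upt_Suc)
qed

definition join :: "nat \<Rightarrow> nat list \<Rightarrow> nat list \<Rightarrow> nat list" where
  "join q = map2 (\<lambda>a l. a * q + l)"

text \<open>The test \<open>if True\<close> only makes the call an instance of \<open>sound_guess_test\<close>.\<close>

primrec guess_tree :: "nat \<Rightarrow> nat \<Rightarrow> nat \<Rightarrow> nat \<Rightarrow> node \<Rightarrow> (tree_var, 'r) cont \<Rightarrow> (tree_var, 'r) ptree" where
  "guess_tree d k q 0 i \<kappa> = Ask (LeafVal i) (\<lambda>v. \<kappa> v id)"
| "guess_tree d k q (Suc n) i \<kappa> =
     gather (\<lambda>j \<kappa>'. guess_tree d k q n (i @ [j]) (\<lambda>v resume. if True then [resume (\<kappa>' (v div q))] else []))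
       (d - 1) [] (\<lambda>his.
     guess_tree d k q n (i @ [d - 1]) (\<lambda>v resume.
       map (\<lambda>los. Ask (FunVal i (join q his los @ [v]))
              (\<lambda>w. \<kappa> w (\<lambda>\<gamma>. resume (verify (\<lambda>j. guess_tree d k q n (i @ [j])) q los 0 \<gamma>))))
         (filter (\<lambda>los. set (join q his los) \<subseteq> {1..k}) (List.n_lists (d - 1) [0..<q]))))"

section \<open>Correctness of the guessing evaluation\<close>

lemma set_n_lists_upt: "set (List.n_lists m [0..<q]) = {ls. set ls \<subseteq> {..<q} \<and> length ls = m}"
  by (auto simp: set_n_lists)

lemma join_div_mod: "join q (map (\<lambda>l. u l div q) ls) (map (\<lambda>l. u l mod q) ls) = map u ls"
  unfolding join_def by (induction ls) auto

lemma map_upt_last: "d \<ge> 1 \<Longrightarrow> map u [0..<d - 1] @ [u (d - 1)] = map u [0..<d]"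
  by (cases d) auto

text \<open>When the function of the node is queried, neither the value of the last child nor the
  low digits are confirmed. A run of the new \<open>resume\<close> confirms first the last child, by
  its own pending checks, and then the low digits; so the argument of the query was correct after
  all.\<close>

lemma sound_guess_tree:
  assumes "d \<ge> 1" "length i + n + 1 = h"
  shows "sound_guess (thrifty_query d h x) x
    (guess_tree d k q n i :: (tree_var, 'r) cont \<Rightarrow> _) (value_above d x n i)"
  using assms(2)
proof (induction n arbitrary: i)
  case 0
  have th: "thrifty_query d h x (LeafVal i)" by (simp add: thrifty_query_def)
  show ?case
    unfolding sound_guess_def
  proof (intro allI impI)
    fix \<kappa> :: "(tree_var, 'r) cont" and b r
    assume "run (thrifty_query d h x) x (guess_tree d k q 0 i \<kappa>) b r"
    then obtain t b2 where "t \<in> set (\<kappa> (x (LeafVal i)) id)" "run (thrifty_query d h x) x t b2 r" "b2 \<longrightarrow> b"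
      using th by (auto elim!: run_AskE)
    then show "\<exists>v resume t b1 b2. t \<in> set (\<kappa> v resume) \<and> run (thrifty_query d h x) x t b2 r \<and> (b1 \<and> b2 \<longrightarrow> b) \<and>
        (\<forall>\<gamma> b' r'. run (thrifty_query d h x) x (resume \<gamma>) b' r' \<longrightarrow>
           v = value_above d x 0 i \<and> b1 \<and> (\<exists>b''. (b'' \<longrightarrow> b') \<and> run (thrifty_query d h x) x \<gamma> b'' r'))"
      by (intro exI[of _ "x (LeafVal i)"] exI[of _ id] exI[of _ t] exI[of _ True] exI[of _ b2]) auto
  qed
next
  case (Suc n)
  define u where "u j = value_above d x n (i @ [j])" for j
  let ?P = "thrifty_query d h x"
  let ?E = "\<lambda>j. guess_tree d k q n (i @ [j]) :: (tree_var, 'r) cont \<Rightarrow> _"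
  have E: "sound_guess ?P x (?E j) (u j)" for j
    unfolding u_def using Suc.prems by (intro Suc.IH) auto
  have args: "map (\<lambda>j. value_above d x n (i @ [j])) [0..<d] = map u [0..<d - 1] @ [u (d - 1)]"
    using map_upt_last[OF assms(1), of u] by (simp add: u_def[abs_def])
  show ?case
    unfolding sound_guess_def
  proof (intro allI impI)
    fix \<kappa> :: "(tree_var, 'r) cont" and b r
    define F where "F his = ?E (d - 1) (\<lambda>v resume.
       map (\<lambda>los. Ask (FunVal i (join q his los @ [v])) (\<lambda>w. \<kappa> w (\<lambda>\<gamma>. resume (verify ?E q los 0 \<gamma>))))
         (filter (\<lambda>los. set (join q his los) \<subseteq> {1..k}) (List.n_lists (d - 1) [0..<q])))" for his
    define his where "his = map (\<lambda>j. u j div q) [0..<d - 1]"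
    assume "run ?P x (guess_tree d k q (Suc n) i \<kappa>) b r"
    then have "run ?P x (gather (\<lambda>j \<kappa>'. ?E j (\<lambda>v resume. if True then [resume (\<kappa>' (v div q))] else []))
       (d - 1) [] F) b r" by (simp add: F_def[abs_def])
    \<comment> \<open>The high digits are already correct at this point, because each of these
      evaluations is resumed at once.\<close>
    then have "\<exists>b'. (b' \<longrightarrow> b) \<and>
        run ?P x (F ([] @ map (\<lambda>j. u j div q) [length ([] :: nat list)..<length ([] :: nat list) + (d - 1)])) b' r"
      by (rule sound_gather[where f = "\<lambda>j. u j div q" and \<kappa> = F, rotated])
        (rule conjunct2[OF sound_guess_test[OF E, where T = "\<lambda>_. True"]])
    then obtain b0 where b0: "b0 \<longrightarrow> b" "run ?P x (F his) b0 r"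
      unfolding append_Nil list.size add_0 his_def by (elim exE conjE)
    then obtain v resume t b1 b2 where *: "t \<in> set (map (\<lambda>los. Ask (FunVal i (join q his los @ [v]))
          (\<lambda>w. \<kappa> w (\<lambda>\<gamma>. resume (verify ?E q los 0 \<gamma>))))
         (filter (\<lambda>los. set (join q his los) \<subseteq> {1..k}) (List.n_lists (d - 1) [0..<q])))"
      "run ?P x t b2 r" "b1 \<and> b2 \<longrightarrow> b0"
      and res: "\<forall>\<gamma> b' r'. run ?P x (resume \<gamma>) b' r' \<longrightarrow>
        v = u (d - 1) \<and> b1 \<and> (\<exists>b''. (b'' \<longrightarrow> b') \<and> run ?P x \<gamma> b'' r')"
      using E[of "d - 1", unfolded sound_guess_def, rule_format, OF b0(2)[unfolded F_def]] by (elim exE conjE) (rule that)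
    then obtain los where los: "length los = d - 1"
      "t = Ask (FunVal i (join q his los @ [v])) (\<lambda>w. \<kappa> w (\<lambda>\<gamma>. resume (verify ?E q los 0 \<gamma>)))"
      by (auto simp: set_n_lists_upt)
    let ?q = "FunVal i (join q his los @ [v])"
    let ?res = "\<lambda>\<gamma>. resume (verify ?E q los 0 \<gamma>)"
    obtain t' b3 where t': "t' \<in> set (\<kappa> (x ?q) ?res)" "run ?P x t' b3 r" "b2 = (?P ?q \<and> b3)"
      using *(2) unfolding los(2) by (rule run_AskE)
    \<comment> \<open>Thriftiness of the query just made joins \<open>b1\<close> as part of the new
      pending flag, to be discharged only by the checks.\<close>
    have "x ?q = value_above d x (Suc n) i \<and> (b1 \<and> ?P ?q) \<and> (\<exists>b''. (b'' \<longrightarrow> b') \<and> run ?P x \<gamma> b'' r')"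
      if ru: "run ?P x (?res \<gamma>) b' r'" for \<gamma> b' r'
    proof -
      obtain b4 where b4: "v = u (d - 1)" b1 "b4 \<longrightarrow> b'" "run ?P x (verify ?E q los 0 \<gamma>) b4 r'"
        using res[rule_format, OF ru] by (elim exE conjE) (rule that)
      have "los = map (\<lambda>l. u l mod q) [0..<d - 1] \<and> (\<exists>b'. (b' \<longrightarrow> b4) \<and> run ?P x \<gamma> b' r')"
        using los(1) by (intro sound_verify[OF E _ b4(4)]) auto
      moreover from this have "join q his los = map u [0..<d - 1]"
        by (simp add: his_def join_div_mod)
      ultimately show ?thesis
        using b4 Suc.prems thrifty_queryI[of i n h d x] by (auto simp: args)
    qed
    note resume = this
    show "\<exists>v resume t b1 b2. t \<in> set (\<kappa> v resume) \<and> run ?P x t b2 r \<and> (b1 \<and> b2 \<longrightarrow> b) \<and>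
        (\<forall>\<gamma> b' r'. run ?P x (resume \<gamma>) b' r' \<longrightarrow>
           v = value_above d x (Suc n) i \<and> b1 \<and> (\<exists>b''. (b'' \<longrightarrow> b') \<and> run ?P x \<gamma> b'' r'))"
      by (intro exI[of _ "x ?q"] exI[of _ ?res] exI[of _ t'] exI[of _ "b1 \<and> ?P ?q"] exI[of _ b3])
        (use t' *(3) b0(1) resume in \<open>intro conjI allI impI; simp\<close>)
  qed
qed

text \<open>The accepting run guesses the true residues modulo \<open>q\<close>; the quotients are
  computed, and \<open>join\<close> rebuilds the actual values of the children.\<close>

lemma complete_guess_tree:
  assumes x: "x \<in> tree_vars d h k \<rightarrow>\<^sub>E {1..k}" and d: "d \<ge> 1" and q: "k < q * q"
    and "set i \<subseteq> {..<d}" "length i + n + 1 = h"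
  shows "complete_guess P x (guess_tree d k q n i :: (tree_var, 'r) cont \<Rightarrow> _) (value_above d x n i)"
  using assms(4,5)
proof (induction n arbitrary: i)
  case 0
  show ?case
    unfolding complete_guess_def by (intro exI[of _ id]) (auto intro: run_Ask)
next
  case (Suc n)
  define u where "u j = value_above d x n (i @ [j])" for j
  let ?E = "\<lambda>j. guess_tree d k q n (i @ [j]) :: (tree_var, 'r) cont \<Rightarrow> _"
  define his where "his = map (\<lambda>j. u j div q) [0..<d - 1]"
  define los where "los = map (\<lambda>j. u j mod q) [0..<d - 1]"
  have E: "complete_guess P x (?E j) (u j)" if "j < d" for j
    unfolding u_def using Suc.prems that by (intro Suc.IH) auto
  have u: "u j \<in> {1..k}" if "j < d" for j
    unfolding u_def using Suc.prems that by (intro value_above_in_range[OF x]) auto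
  have join: "join q his los = map u [0..<d - 1]"
    by (simp add: his_def los_def join_div_mod)
  have q0: "q > 0" using q by (cases q) auto
  \<comment> \<open>The true low digits survive the filter, which keeps every queried argument
    inside the range of the input variables.\<close>
  have los_ok: "los \<in> set (filter (\<lambda>los. set (join q his los) \<subseteq> {1..k}) (List.n_lists (d - 1) [0..<q]))"
  proof -
    have "set los \<subseteq> {..<q}" "length los = d - 1"
      using q0 by (auto simp: los_def)
    moreover have "set (join q his los) \<subseteq> {1..k}"
      unfolding join using u by force
    ultimately show ?thesis by (simp add: set_n_lists_upt)
  qed
  have w: "x (FunVal i (join q his los @ [u (d - 1)])) = value_above d x (Suc n) i"
    using map_upt_last[OF d, of u] by (simp add: join u_def[abs_def])
  have "complete_guess P x (?E (d - 1)) (u (d - 1))"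
    using E d by simp
  then obtain res where res:
    "\<forall>\<gamma> r. (\<exists>b. run P x \<gamma> b r) \<longrightarrow> (\<exists>b. run P x (res \<gamma>) b r)"
    "\<forall>\<kappa> t r. t \<in> set (\<kappa> (u (d - 1)) res) \<longrightarrow> (\<exists>b. run P x t b r) \<longrightarrow> (\<exists>b. run P x (?E (d - 1) \<kappa>) b r)"
    unfolding complete_guess_def by (elim exE conjE)
  let ?res = "\<lambda>\<gamma>. res (verify ?E q los 0 \<gamma>)"
  show ?case
    unfolding complete_guess_def
  proof (intro exI[of _ ?res] conjI allI impI)
    fix \<gamma> :: "(tree_var, 'r) ptree" and r assume "\<exists>b. run P x \<gamma> b r"
    then show "\<exists>b. run P x (?res \<gamma>) b r"
      unfolding los_def using E by (intro res(1)[rule_format] complete_verify) auto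
  next
    fix \<kappa> :: "(tree_var, 'r) cont" and t r
    assume t: "t \<in> set (\<kappa> (value_above d x (Suc n) i) ?res)" "\<exists>b. run P x t b r"
    let ?A = "\<lambda>his v resume los. Ask (FunVal i (join q his los @ [v])) (\<lambda>w. \<kappa> w (\<lambda>\<gamma>. resume (verify ?E q los 0 \<gamma>)))"
    let ?F = "\<lambda>his. ?E (d - 1) (\<lambda>v resume. map (?A his v resume)
         (filter (\<lambda>los. set (join q his los) \<subseteq> {1..k}) (List.n_lists (d - 1) [0..<q])))"
    have "\<exists>b. run P x (?A his (u (d - 1)) res los) b r"
      using t w run_Ask[of t "\<lambda>w. \<kappa> w ?res" x "FunVal i (join q his los @ [u (d - 1)])" P _ r] by auto
    then have F: "\<exists>b. run P x (?F his) b r"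
      using los_ok by (intro res(2)[rule_format]) auto
    have "\<exists>b. run P x (gather (\<lambda>j \<kappa>'. ?E j (\<lambda>v resume. if True then [resume (\<kappa>' (v div q))] else []))
       (d - 1) [] ?F) b r"
    proof (rule complete_gather[where f = "\<lambda>j. u j div q"])
      show "\<exists>b. run P x (?F ([] @ map (\<lambda>j. u j div q) [length []..<length [] + (d - 1)])) b r"
        using F by (simp add: his_def)
      fix j \<kappa>' assume "j < length [] + (d - 1)" "\<exists>b. run P x (\<kappa>' (u j div q)) b r"
      then show "\<exists>b. run P x (?E j (\<lambda>v resume. if True then [resume (\<kappa>' (v div q))] else [])) b r"
        by (intro complete_guess_test[OF E]) auto
    qed
    then show "\<exists>b. run P x (guess_tree d k q (Suc n) i \<kappa>) b r" by simp
  qed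
qed

section \<open>Counting the states of the guessing evaluation\<close>

primrec resumptions :: "nat \<Rightarrow> nat \<Rightarrow> nat \<Rightarrow> nat \<Rightarrow> node \<Rightarrow> ((tree_var, 'r) ptree \<Rightarrow> (tree_var, 'r) ptree) set" where
  "resumptions d k q 0 i = {id}"
| "resumptions d k q (Suc n) i =
     (\<lambda>(los, resume) \<gamma>. resume (verify (\<lambda>j. guess_tree d k q n (i @ [j])) q los 0 \<gamma>)) `
       ({ls. set ls \<subseteq> {..<q} \<and> length ls = d - 1} \<times> resumptions d k q n (i @ [d - 1]))"

lemma finite_digits: "finite {ls. set ls \<subseteq> {..<q::nat} \<and> length ls = m}"
  by (rule finite_lists_length_eq) simp

lemma card_digits: "card {ls. set ls \<subseteq> {..<q::nat} \<and> length ls = m} = q ^ m"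
  using card_lists_length_eq[of "{..<q}" m] by simp

text \<open>A pending \<open>resume\<close> remembers only the low digits guessed along the path of
  last children below the node, \<open>d - 1\<close> of them on each of \<open>n\<close> levels.
  High digits and claimed values have dropped out.\<close>

lemma resumptions_card:
  "finite (resumptions d k q n i :: ((tree_var, 'r) ptree \<Rightarrow> _) set) \<and>
   card (resumptions d k q n i :: ((tree_var, 'r) ptree \<Rightarrow> _) set) \<le> q ^ ((d - 1) * n)"
proof (induction n arbitrary: i)
  case (Suc n)
  let ?D = "{ls. set ls \<subseteq> {..<q} \<and> length ls = d - 1}"
  let ?R = "resumptions d k q n (i @ [d - 1]) :: ((tree_var, 'r) ptree \<Rightarrow> _) set"
  have fin: "finite (?D \<times> ?R)"
    using Suc finite_digits by blast
  have "card (?D \<times> ?R) \<le> q ^ (d - 1) * q ^ ((d - 1) * n)"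
    unfolding card_cartesian_product card_digits using Suc by (intro mult_le_mono2) blast
  also have "\<dots> = q ^ ((d - 1) * Suc n)"
    by (simp add: power_add)
  finally show ?case
    unfolding resumptions.simps using fin
    by (meson card_image_le finite_imageI order_trans)
qed simp

text \<open>The first bound covers the phase up to the claim, the second the phase of the pending
  checks. The second one counts all resumptions of a fixed \<open>\<gamma>\<close> together, so a
  caller pays again only for what \<open>\<gamma>\<close> remembers.\<close>

definition guess_covers ::
  "nat \<Rightarrow> (tree_var, 'r) ptree set \<Rightarrow> nat \<Rightarrow> ((tree_var, 'r) cont \<Rightarrow> (tree_var, 'r) ptree) \<Rightarrow>
   ((tree_var, 'r) ptree \<Rightarrow> (tree_var, 'r) ptree) set \<Rightarrow> bool" where
  "guess_covers k A c E R \<longleftrightarrow>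
     (\<forall>\<kappa>. covers k A c {E \<kappa>} (\<Union>v\<in>{1..k}. \<Union>resume\<in>R. set (\<kappa> v resume))) \<and>
     (\<forall>\<gamma>. covers k A c ((\<lambda>resume. resume \<gamma>) ` R) {\<gamma>})"

lemma guess_covers_mono:
  "guess_covers k A c E R \<Longrightarrow> c \<le> c' \<Longrightarrow> guess_covers k A c' E R"
  unfolding guess_covers_def by (meson covers_mono subset_refl)

text \<open>Each check costs \<open>c\<close> up to the claim and \<open>c\<close> for its
  resumption. With \<open>l\<close> digits still to be checked there are \<open>q ^ l\<close>
  copies, since checked digits are forgotten; the sum over \<open>l\<close> from 1 to
  \<open>m\<close> is at most \<open>m * q ^ m\<close>.\<close>

lemma covers_verify:
  assumes E: "\<And>j. j < d \<Longrightarrow> guess_covers k A c (E j) (R j)" and "j + m \<le> d" and q: "q \<ge> 1"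
  shows "covers k A (m * q ^ m * (2 * c))
    ((\<lambda>ls. verify E q ls j \<gamma>) ` {ls. set ls \<subseteq> {..<q} \<and> length ls = m}) {\<gamma>}"
  using assms(2)
proof (induction m arbitrary: j)
  case 0
  have "{ls :: nat list. set ls \<subseteq> {..<q} \<and> length ls = 0} = {[]}" by auto
  then show ?case by (simp add: covers_subset)
next
  case (Suc m)
  let ?D = "\<lambda>m. {ls. set ls \<subseteq> {..<q} \<and> length ls = m}"
  let ?V = "(\<lambda>ls. verify E q ls (Suc j) \<gamma>) ` ?D m"
  have Ej: "guess_covers k A c (E j) (R j)" using Suc.prems by (intro E) auto
  have 1: "covers k A (q ^ Suc m * (2 * c)) ((\<lambda>ls. verify E q ls j \<gamma>) ` ?D (Suc m)) ?V"
  proof (rule covers_image)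
    fix ls assume "ls \<in> ?D (Suc m)"
    then obtain l ls' where ls: "ls = l # ls'" "ls' \<in> ?D m" by (cases ls) auto
    let ?\<kappa> = "\<lambda>v resume. if v mod q = l then [resume (verify E q ls' (Suc j) \<gamma>)] else []"
    have "covers k A c {E j ?\<kappa>} (\<Union>v\<in>{1..k}. \<Union>resume\<in>R j. set (?\<kappa> v resume))"
      using Ej unfolding guess_covers_def by blast
    then have "covers k A c {E j ?\<kappa>} ((\<lambda>resume. resume (verify E q ls' (Suc j) \<gamma>)) ` R j)"
      by (rule covers_mono) auto
    moreover have "covers k A c ((\<lambda>resume. resume (verify E q ls' (Suc j) \<gamma>)) ` R j) {verify E q ls' (Suc j) \<gamma>}"
      using Ej unfolding guess_covers_def by blast
    ultimately have "covers k A (c + c) {E j ?\<kappa>} {verify E q ls' (Suc j) \<gamma>}"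
      by (rule covers_trans)
    then show "covers k A (2 * c) {verify E q ls j \<gamma>} ?V"
      by (rule covers_mono) (use ls in auto)
  qed (use finite_digits card_digits in auto)
  have 2: "covers k A (m * q ^ m * (2 * c)) ?V {\<gamma>}"
    using Suc.prems by (intro Suc.IH) auto
  have "m * q ^ m * (2 * c) \<le> m * q ^ Suc m * (2 * c)"
    using q by (intro mult_le_mono) auto
  then show ?case
    by (intro covers_mono[OF covers_trans[OF 1 2]]) (auto simp: algebra_simps)
qed

text \<open>With \<open>e = d - 1\<close>, \<open>q ^ e\<close> copies of a child of cost
  \<open>c\<close> cost \<open>C * Q\<close>. Every part of the computation at the new node is a
  bounded multiple of this, apart from the query states, of which there are at most
  \<open>Q\<close>.\<close>

lemma guess_covers_Suc:
  assumes d: "d \<ge> 2" and q: "q \<ge> 1" "k < q * q" and i: "set i \<subseteq> {..<d}" "length i + Suc n + 1 = h"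
    and E: "\<And>j. j < d \<Longrightarrow> guess_covers k (ask_trees (tree_vars d h k)) (C * q ^ ((d - 1) * Suc n + 2))
      (guess_tree d k q n (i @ [j]) :: (tree_var, 'r) cont \<Rightarrow> _) (resumptions d k q n (i @ [j]))"
  shows "guess_covers k (ask_trees (tree_vars d h k)) ((2 * d * C + 1) * q ^ ((d - 1) * Suc (Suc n) + 2))
    (guess_tree d k q (Suc n) i :: (tree_var, 'r) cont \<Rightarrow> _) (resumptions d k q (Suc n) i)"
proof -
  define e where "e = d - 1"
  define c where "c = C * q ^ ((d - 1) * Suc n + 2)"
  define Q where "Q = q ^ ((d - 1) * Suc (Suc n) + 2)"
  let ?A = "ask_trees (tree_vars d h k) :: (tree_var, 'r) ptree set"
  let ?E = "\<lambda>j. guess_tree d k q n (i @ [j]) :: (tree_var, 'r) cont \<Rightarrow> _"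
  let ?R = "\<lambda>j. resumptions d k q n (i @ [j]) :: ((tree_var, 'r) ptree \<Rightarrow> _) set"
  let ?D = "{ls. set ls \<subseteq> {..<q} \<and> length ls = e}"
  have de: "d = Suc e" using d by (simp add: e_def)
  have cQ: "q ^ e * c = C * Q"
    by (simp add: c_def Q_def e_def power_add)
  have E1: "covers k ?A c {?E j \<kappa>} (\<Union>v\<in>{1..k}. \<Union>resume\<in>?R j. set (\<kappa> v resume))" if "j < d" for j \<kappa>
    using E[OF that] unfolding guess_covers_def c_def by blast
  have E2: "covers k ?A c ((\<lambda>resume. resume \<gamma>) ` ?R j) {\<gamma>}" if "j < d" for j \<gamma>
    using E[OF that] unfolding guess_covers_def c_def by blast
  let ?res = "\<lambda>los resume \<gamma>. resume (verify ?E q los 0 \<gamma>) :: (tree_var, 'r) ptree"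
  have phase1: "covers k ?A ((2 * d * C + 1) * Q) {guess_tree d k q (Suc n) i \<kappa>}
      (\<Union>v\<in>{1..k}. \<Union>resume\<in>resumptions d k q (Suc n) i. set (\<kappa> v resume))" for \<kappa> :: "(tree_var, 'r) cont"
  proof -
    let ?G = "\<lambda>j \<kappa>'. ?E j (\<lambda>v resume. if True then [resume (\<kappa>' (v div q))] else [])"
    define ask where "ask his v resume los =
      Ask (FunVal i (join q his los @ [v])) (\<lambda>w. \<kappa> w (?res los resume))" for his v resume los
    define F where "F his = ?E e (\<lambda>v resume. map (ask his v resume)
      (filter (\<lambda>los. set (join q his los) \<subseteq> {1..k}) (List.n_lists e [0..<q])))" for his
    \<comment> \<open>These tuples index the query states, where most is remembered: high digits,
      claim, deeper low digits and new low digits. They allow \<open>q ^ e\<close>, fewer than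
      \<open>q * q\<close>, \<open>q ^ (e * n)\<close> and \<open>q ^ e\<close> possibilities
      respectively, which is where the exponent in \<open>Q\<close> comes from.\<close>
    define I where "I = {(his, v, resume, los). his \<in> ?D \<and> v \<in> {1..k} \<and> resume \<in> ?R e \<and> los \<in> ?D \<and>
      set (join q his los) \<subseteq> {1..k}}"
    have tree: "guess_tree d k q (Suc n) i \<kappa> = gather ?G e [] F"
      by (simp add: F_def[abs_def] ask_def[abs_def] e_def)
    \<comment> \<open>One \<open>c\<close> leads to the claim and \<open>q * c\<close> pays for the
      checks, since a high digit must be kept meanwhile. By \<open>k < q * q\<close>, that digit is
      below \<open>q\<close>.\<close>
    have step: "covers k ?A ((1 + q) * c) {?G j \<kappa>'} (\<kappa>' ` {..<q})" if "j < d" for j \<kappa>'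
    proof -
      have "covers k ?A c {?G j \<kappa>'} (\<Union>a\<in>{..<q}. (\<lambda>resume. resume (\<kappa>' a)) ` ?R j)"
      proof (rule covers_mono[OF E1[OF that]])
        have "v div q < q" if "v \<le> k" for v
          using that q by (simp add: less_mult_imp_div_less)
        then show "(\<Union>v\<in>{1..k}. \<Union>resume\<in>?R j. set (if True then [resume (\<kappa>' (v div q))] else []))
            \<subseteq> (\<Union>a\<in>{..<q}. (\<lambda>resume. resume (\<kappa>' a)) ` ?R j)"
          by fastforce
      qed auto
      moreover have "covers k ?A (q * c) (\<Union>a\<in>{..<q}. (\<lambda>resume. resume (\<kappa>' a)) ` ?R j) (\<kappa>' ` {..<q})"
      proof (rule covers_UN)
        fix a assume "a \<in> {..<q}"
        then show "covers k ?A c ((\<lambda>resume. resume (\<kappa>' a)) ` ?R j) (\<kappa>' ` {..<q})"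
          by (intro covers_mono[OF E2[OF that]]) auto
      qed auto
      ultimately have "covers k ?A (c + q * c) {?G j \<kappa>'} (\<kappa>' ` {..<q})" by (rule covers_trans)
      then show ?thesis by simp
    qed
    have 1: "covers k ?A (e * q ^ (e - 1) * ((1 + q) * c)) {gather ?G e [] F} (F ` ?D)"
      using covers_gather[of "[]" e k ?A "(1 + q) * c" ?G "{..<q}" q F] step q de by auto
    have 2: "covers k ?A (q ^ e * c) (F ` ?D) ((\<lambda>(his, v, resume, los). ask his v resume los) ` I)"
    proof (rule covers_image)
      fix his assume his: "his \<in> ?D"
      show "covers k ?A c {F his} ((\<lambda>(his, v, resume, los). ask his v resume los) ` I)"
        unfolding F_def
        by (rule covers_mono[OF E1]) (use his de in \<open>force simp: set_n_lists_upt I_def\<close>)+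
    qed (use finite_digits card_digits in auto)
    have finI: "finite I" and cardI: "card I \<le> Q"
    proof -
      have sub: "I \<subseteq> ?D \<times> {1..k} \<times> ?R e \<times> ?D" by (auto simp: I_def)
      have fin: "finite (?D \<times> {1..k} \<times> ?R e \<times> ?D)"
        by (intro finite_cartesian_product finite_digits finite_atLeastAtMost conjunct1[OF resumptions_card])
      show "finite I" using sub fin by (rule finite_subset)
      have "card I \<le> card (?D \<times> {1..k} \<times> ?R e \<times> ?D)"
        using sub fin by (rule card_mono[rotated])
      also have "\<dots> = q ^ e * (k * (card (?R e) * q ^ e))"
        by (simp only: card_cartesian_product card_digits card_atLeastAtMost diff_Suc_1)
      also have "\<dots> \<le> q ^ e * (q * q * (q ^ (e * n) * q ^ e))"
        using q(2) conjunct2[OF resumptions_card[of d k q n "i @ [e]"]] e_def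
        by (intro mult_le_mono order_refl) auto
      also have "\<dots> = Q"
        by (simp add: Q_def e_def power_add power2_eq_square)
      finally show "card I \<le> Q" .
    qed
    have 3: "covers k ?A (Q * 1) ((\<lambda>(his, v, resume, los). ask his v resume los) ` I)
        (\<Union>v\<in>{1..k}. \<Union>resume\<in>resumptions d k q (Suc n) i. set (\<kappa> v resume))"
    proof (rule covers_image[OF finI cardI])
      fix z assume "z \<in> I"
      then obtain his v resume los where z: "z = (his, v, resume, los)" "his \<in> ?D" "v \<in> {1..k}"
        "resume \<in> ?R e" "los \<in> ?D" "set (join q his los) \<subseteq> {1..k}"
        by (auto simp: I_def)
      have "FunVal i (join q his los @ [v]) \<in> tree_vars d h k"
        using i z de by (intro FunVal_in_tree_vars) (auto simp: join_def)
      then have "covers k ?A 1 {ask his v resume los} (\<Union>w\<in>{1..k}. set (\<kappa> w (?res los resume)))"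
        unfolding ask_def by (intro covers_Ask) (auto simp: ask_trees_def)
      moreover have "?res los resume \<in> resumptions d k q (Suc n) i"
        using z(4,5) by (force simp: e_def)
      ultimately show "covers k ?A 1 {case z of (his, v, resume, los) \<Rightarrow> ask his v resume los}
            (\<Union>v\<in>{1..k}. \<Union>resume\<in>resumptions d k q (Suc n) i. set (\<kappa> v resume))"
        unfolding z prod.case by (elim covers_mono) blast+
    qed
    have "e * q ^ (e - 1) * ((1 + q) * c) \<le> e * q ^ (e - 1) * ((2 * q) * c)"
      using q(1) by (intro mult_le_mono) auto
    also have "\<dots> = e * 2 * (q ^ Suc (e - 1) * c)" by simp
    also have "Suc (e - 1) = e" using d by (simp add: e_def)
    finally have "e * q ^ (e - 1) * ((1 + q) * c) + q ^ e * c + Q * 1 \<le> e * 2 * (C * Q) + C * Q + Q"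
      unfolding cQ by simp
    also have "\<dots> \<le> (2 * d * C + 1) * Q"
      by (simp add: de algebra_simps)
    finally show ?thesis
      unfolding tree by (intro covers_mono[OF covers_trans[OF covers_trans[OF 1 2] 3]]) auto
  qed
  \<comment> \<open>The checks of the last child run with the \<open>e\<close> low digits of this
    node in memory; then these digits are verified and forgotten one by one.\<close>
  have phase2: "covers k ?A ((2 * d * C + 1) * Q) ((\<lambda>resume. resume \<gamma>) ` resumptions d k q (Suc n) i) {\<gamma>}"
    for \<gamma> :: "(tree_var, 'r) ptree"
  proof -
    let ?V = "\<lambda>los. verify ?E q los 0 \<gamma>"
    have 1: "covers k ?A (q ^ e * c) (\<Union>los\<in>?D. (\<lambda>resume. resume (?V los)) ` ?R e) (?V ` ?D)"
    proof (rule covers_UN)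
      fix los assume "los \<in> ?D"
      then show "covers k ?A c ((\<lambda>resume. resume (?V los)) ` ?R e) (?V ` ?D)"
        by (intro covers_mono[OF E2[of e]]) (use de in auto)
    qed (use finite_digits card_digits in auto)
    have 2: "covers k ?A (e * q ^ e * (2 * c)) (?V ` ?D) {\<gamma>}"
      using de q(1) by (intro covers_verify[OF E[folded c_def]]) auto
    have "q ^ e * c + e * q ^ e * (2 * c) = C * Q + 2 * e * (C * Q)"
      unfolding cQ[symmetric] by simp
    also have "\<dots> \<le> (2 * d * C + 1) * Q"
      by (simp add: de algebra_simps)
    finally show ?thesis
      by (intro covers_mono[OF covers_trans[OF 1 2]]) (auto simp: e_def)
  qed
  show ?thesis
    using phase1 phase2 unfolding guess_covers_def Q_def by blast
qed

lemma guess_covers_guess_tree: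
  assumes d: "d \<ge> 2"
  shows "\<exists>C. \<forall>k q i. q \<ge> 1 \<longrightarrow> k < q * q \<longrightarrow> set i \<subseteq> {..<d} \<longrightarrow> length i + n + 1 = h \<longrightarrow>
    guess_covers k (ask_trees (tree_vars d h k)) (C * q ^ ((d - 1) * Suc n + 2))
      (guess_tree d k q n i :: (tree_var, 'r) cont \<Rightarrow> _) (resumptions d k q n i)"
proof (induction n)
  case 0
  have "guess_covers k (ask_trees (tree_vars d h k)) (1 * q ^ ((d - 1) * Suc 0 + 2))
      (guess_tree d k q 0 i :: (tree_var, 'r) cont \<Rightarrow> _) (resumptions d k q 0 i)"
    if "q \<ge> 1" "set i \<subseteq> {..<d}" "length i + 0 + 1 = h" for k q :: nat and i
  proof (rule guess_covers_mono)
    have "LeafVal i \<in> tree_vars d h k"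
      using that by (intro LeafVal_in_tree_vars) auto
    then have "covers k (ask_trees (tree_vars d h k)) 1 {Ask (LeafVal i) (\<lambda>v. \<kappa> v id)} (\<Union>v\<in>{1..k}. set (\<kappa> v id))"
      for \<kappa> :: "(tree_var, 'r) cont"
      by (intro covers_Ask) (auto simp: ask_trees_def)
    moreover have "covers k (ask_trees (tree_vars d h k)) 1 {\<gamma>} {\<gamma>}" for \<gamma> :: "(tree_var, 'r) ptree"
      by (rule covers_mono[OF covers_subset]) auto
    ultimately show "guess_covers k (ask_trees (tree_vars d h k)) 1
      (guess_tree d k q 0 i :: (tree_var, 'r) cont \<Rightarrow> _) (resumptions d k q 0 i)"
      unfolding guess_covers_def by simp
  qed (use that in simp)
  then show ?case by blast
next
  case (Suc n)
  then obtain C where C: "\<And>(k :: nat) q i. q \<ge> 1 \<Longrightarrow> k < q * q \<Longrightarrow> set i \<subseteq> {..<d} \<Longrightarrow> length i + n + 1 = h \<Longrightarrow>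
    guess_covers k (ask_trees (tree_vars d h k)) (C * q ^ ((d - 1) * Suc n + 2))
      (guess_tree d k q n i :: (tree_var, 'r) cont \<Rightarrow> _) (resumptions d k q n i)" by blast
  show ?case
  proof (intro exI[of _ "2 * d * C + 1"] allI impI)
    fix k q :: nat and i assume "1 \<le> q" "k < q * q" "set i \<subseteq> {..<d}" "length i + Suc n + 1 = h"
    then show "guess_covers k (ask_trees (tree_vars d h k)) ((2 * d * C + 1) * q ^ ((d - 1) * Suc (Suc n) + 2))
      (guess_tree d k q (Suc n) i :: (tree_var, 'r) cont \<Rightarrow> _) (resumptions d k q (Suc n) i)"
      using C d by (intro guess_covers_Suc) auto
  qed
qed

lemma ndet_BT_program:
  assumes d: "d \<ge> 2" and h: "h \<ge> 2"
  shows "\<exists>C. \<forall>k q. 1 \<le> q \<longrightarrow> k < q * q \<longrightarrow> (\<exists>B. ndet_solves_BT d h k B \<and> ndet_thrifty d h k B \<and>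
    bp_size B \<le> C * q ^ ((d - 1) * h + 2))"
proof -
  define n where "n = h - 1"
  have hn: "h = Suc n" using h by (simp add: n_def)
  obtain C where C: "\<And>(k :: nat) q i. q \<ge> 1 \<Longrightarrow> k < q * q \<Longrightarrow> set i \<subseteq> {..<d} \<Longrightarrow> length i + n + 1 = h \<Longrightarrow>
    guess_covers k (ask_trees (tree_vars d h k)) (C * q ^ ((d - 1) * Suc n + 2))
      (guess_tree d k q n i :: (tree_var, bool) cont \<Rightarrow> _) (resumptions d k q n i)"
    using guess_covers_guess_tree[OF d, of n h] by blast
  have "\<exists>B. ndet_solves_BT d h k B \<and> ndet_thrifty d h k B \<and> bp_size B \<le> (3 * C + 2) * q ^ ((d - 1) * h + 2)"
    if q: "1 \<le> q" "k < q * q" for k q :: nat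
  proof -
    let ?V = "tree_vars d h k"
    let ?A = "ask_trees ?V :: (tree_var, bool) ptree set"
    let ?E = "guess_tree d k q n [] :: (tree_var, bool) cont \<Rightarrow> _"
    let ?R = "resumptions d k q n [] :: ((tree_var, bool) ptree \<Rightarrow> _) set"
    define c where "c = C * q ^ ((d - 1) * h + 2)"
    define t where "t = ?E (\<lambda>v resume. if True then [resume (Out (v = 1))] else [])"
    have E: "guess_covers k ?A c ?E ?R"
      using C[of q k "[]"] q hn by (simp add: c_def)
    have 1: "covers k ?A c {t} (\<Union>b\<in>UNIV. (\<lambda>resume. resume (Out b)) ` ?R)"
      unfolding t_def
    proof (rule covers_mono[OF conjunct1[OF E[unfolded guess_covers_def], rule_format]])
      show "(\<Union>v\<in>{1..k}. \<Union>resume\<in>?R. set (if True then [resume (Out (v = 1))] else []))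
          \<subseteq> (\<Union>b\<in>UNIV. (\<lambda>resume. resume (Out b)) ` ?R)"
      proof
        fix z assume "z \<in> (\<Union>v\<in>{1..k}. \<Union>resume\<in>?R. set (if True then [resume (Out (v = 1))] else []))"
        then obtain v resume where "resume \<in> ?R" "z = resume (Out (v = (1::nat)))" by auto
        then show "z \<in> (\<Union>b\<in>UNIV. (\<lambda>resume. resume (Out b)) ` ?R)" by blast
      qed
    qed auto
    \<comment> \<open>At the root only the truth value of the claim is kept during the final checks,
      hence two copies of them.\<close>
    have 2: "covers k ?A (2 * c) (\<Union>b\<in>UNIV. (\<lambda>resume. resume (Out b)) ` ?R) (Out ` UNIV)"
    proof (rule covers_UN)
      fix b :: bool
      show "covers k ?A c ((\<lambda>resume. resume (Out b)) ` ?R) (Out ` UNIV)"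
        by (rule covers_mono[OF conjunct2[OF E[unfolded guess_covers_def], rule_format]]) auto
    qed (auto simp: card_UNIV_bool)
    obtain B :: "(nat, tree_var, bool) bprog" where B:
      "branching_program k ?V UNIV B" "bp_size B \<le> c + 2 * c + card (UNIV :: bool set)"
      "\<And>x p. activated_path B x p \<Longrightarrow> trace x t (map (bp_label B) p)"
      "\<And>x ls. x \<in> ?V \<rightarrow>\<^sub>E {1..k} \<Longrightarrow> trace x t ls \<Longrightarrow> \<exists>p. activated_path B x p \<and> map (bp_label B) p = ls"
      by (rule program_of_ptree[OF covers_trans[OF 1 2] order_refl]) auto
    have root: "value_above d x n [] = node_value d h x []" for x
      by (simp add: node_value_def n_def)
    have sound: "r = BT d h x \<and> (\<forall>q. Query q \<in> set ls \<longrightarrow> thrifty_query d h x q)"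
      if tr: "trace x t ls" "last ls = Final r" for x ls r
    proof -
      obtain b where b: "run (thrifty_query d h x) x t b r"
        "b \<longrightarrow> (\<forall>q. Query q \<in> set ls \<longrightarrow> thrifty_query d h x q)"
        using run_of_trace[OF tr] by blast
      have "sound_guess (thrifty_query d h x) x ?E (value_above d x n [])"
        using d hn by (intro sound_guess_tree) auto
      from sound_guess_test[OF this b(1)[unfolded t_def]]
      obtain b' where "b' \<longrightarrow> b" "run (thrifty_query d h x) x (Out (value_above d x n [] = 1)) b' r"
        by blast
      then show ?thesis using b(2) by (auto simp: BT_def root elim: run_OutE)
    qed
    have ex: "\<exists>ls. trace x t ls \<and> last ls = Final (BT d h x)" if x: "x \<in> ?V \<rightarrow>\<^sub>E {1..k}" for x
    proof -
      have "complete_guess (\<lambda>_. True) x ?E (value_above d x n [])"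
        using d hn q by (intro complete_guess_tree[OF x]) auto
      moreover have "\<exists>b. run (\<lambda>_. True) x (Out (value_above d x n [] = 1)) b (BT d h x)"
        unfolding BT_def root by (blast intro: run_Out)
      ultimately have "\<exists>b. run (\<lambda>_. True) x t b (BT d h x)"
        unfolding t_def by (intro complete_guess_test) auto
      then show ?thesis by (elim exE) (rule trace_of_run)
    qed
    have "computes k ?V B (BT d h)"
      using sound ex by (intro computes_of_traces[OF B(3,4)]) auto
    moreover have "ndet_thrifty d h k B"
      unfolding ndet_thrifty_def thrifty_at_iff
    proof (intro ballI allI impI)
      fix x p s q
      assume p: "finite_computation B x p \<and> final_state B (last p)" and s: "s \<in> set p" "bp_label B s = Query q"
      then obtain r where "activated_path B x p" "bp_label B (last p) = Final r"
        by (auto simp: finite_computation_def final_state_def)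
      moreover from this have "last (map (bp_label B) p) = Final r"
        by (simp add: last_map activated_path_def)
      moreover have "Query q \<in> set (map (bp_label B) p)" using s by force
      ultimately show "thrifty_query d h x q" using sound[OF B(3)] by blast
    qed
    moreover have "bp_size B \<le> (3 * C + 2) * q ^ ((d - 1) * h + 2)"
    proof -
      have "1 \<le> q ^ ((d - 1) * h + 2)" using q by (intro one_le_power)
      then show ?thesis using B(2) unfolding c_def card_UNIV_bool add_mult_distrib by linarith
    qed
    ultimately show ?thesis using B(1) unfolding ndet_solves_BT_def by blast
  qed
  then show ?thesis by blast
qed

subsection \<open>Asymptotics\<close>

lemma nat_sqrt_base:
  assumes "k \<ge> 1"
  obtains q :: nat where "q \<ge> 1" "k < q * q" "real q \<le> 2 * sqrt (real k)"
proof -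
  \<comment> \<open>Adding 1 to the floor makes \<open>k < q * q\<close> strict also for perfect
    squares, and costs at most a factor 2 because the square root is at least 1.\<close>
  define q where "q = nat \<lfloor>sqrt (real k)\<rfloor> + 1"
  have "q \<ge> 1" by (simp add: q_def)
  have s: "sqrt (real k) \<ge> 1" using assms by simp
  have "sqrt (real k) < real q" unfolding q_def using s by linarith
  then have "sqrt (real k) * sqrt (real k) < real q * real q"
    using s by (intro mult_strict_mono) linarith+
  then have "k < q * q"
    by (simp flip: of_nat_mult)
  moreover have "real q \<le> 2 * sqrt (real k)"
    unfolding q_def using s by linarith
  ultimately show thesis using that[of q] \<open>q \<ge> 1\<close> by simp
qed

theorem theorem5p1:
  fixes d h :: nat
  assumes "d \<ge> 2" and "h \<ge> 2"
  shows
    "(\<lambda>k. real (detFstates d h k))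
        \<in> O(\<lambda>k. real k powr ((real d - 1) * real h - real d + 2)) \<and>
     (h \<ge> 3 \<longrightarrow>
      (\<lambda>k. real (detBstates d h k))
        \<in> O(\<lambda>k. real k powr ((real d - 1) * real h - real d + 2) / log 2 (real k))) \<and>
     (\<lambda>k. real (ndetBstates d h k))
        \<in> O(\<lambda>k. real k powr ((real d - 1) * real h / 2 + 1)) \<and>
     (\<exists>B. (\<forall>k\<ge>2. det_solves_FT d h k (B k) \<and> det_thrifty d h k (B k)) \<and>
          (\<lambda>k. real (bp_size (B k)))
            \<in> O(\<lambda>k. real k powr ((real d - 1) * real h - real d + 2))) \<and>
     (\<exists>B. (\<forall>k\<ge>2. ndet_solves_BT d h k (B k) \<and> ndet_thrifty d h k (B k)) \<and>
          (\<lambda>k. real (bp_size (B k)))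
            \<in> O(\<lambda>k. real k powr ((real d - 1) * real h / 2 + 1)))"
proof -
  define M where "M = (d - 1) * (h - 1) + 1"
  \<comment> \<open>The real exponent of the statement is the natural number \<open>M\<close>, as
    \<open>(d - 1) * h - d + 2 = (d - 1) * (h - 1) + 1\<close>.\<close>
  have powM: "real k powr ((real d - 1) * real h - real d + 2) = real (k ^ M)" if "k \<ge> 2" for k
  proof -
    have "(real d - 1) * real h - real d + 2 = real M"
      using assms unfolding M_def by (cases d; cases h) (simp_all add: algebra_simps)
    then show ?thesis using that by (simp add: powr_realpow)
  qed
  have powN: "real q ^ ((d - 1) * h + 2) \<le> 2 ^ ((d - 1) * h + 2) * real k powr ((real d - 1) * real h / 2 + 1)"
    if "real q \<le> 2 * sqrt (real k)" "k \<ge> 2" for k q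
  proof -
    let ?N = "(d - 1) * h + 2"
    have "real q ^ ?N \<le> (2 * sqrt (real k)) ^ ?N"
      using that(1) by (intro power_mono) auto
    also have "\<dots> = 2 ^ ?N * (real k powr (1 / 2)) ^ ?N"
      by (simp only: power_mult_distrib powr_half_sqrt of_nat_0_le_iff)
    also have "(real k powr (1 / 2)) ^ ?N = real k powr (1 / 2 * real ?N)"
      using that(2) by (subst powr_realpow[symmetric]) (auto simp: powr_powr)
    also have "1 / 2 * real ?N = (real d - 1) * real h / 2 + 1"
      using assms by (simp add: of_nat_diff field_simps)
    finally show ?thesis .
  qed

  obtain C1 where C1: "\<forall>k\<ge>1. \<exists>B. det_solves_FT d h k B \<and> det_thrifty d h k B \<and> bp_size B \<le> C1 * k ^ M"
    using det_FT_program[OF assms, folded M_def] by (elim exE) (rule that)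
  define B1 where "B1 k = (SOME B. det_solves_FT d h k B \<and> det_thrifty d h k B \<and> bp_size B \<le> C1 * k ^ M)" for k
  have B1: "det_solves_FT d h k (B1 k) \<and> det_thrifty d h k (B1 k) \<and> bp_size (B1 k) \<le> C1 * k ^ M"
    if "k \<ge> 2" for k
    unfolding B1_def by (rule someI_ex, rule C1[rule_format]) (use that in simp)
  have size1: "(\<lambda>k. real (bp_size (B1 k))) \<in> O(\<lambda>k. real k powr ((real d - 1) * real h - real d + 2))"
  proof (rule bigoI[where c = "real C1"], rule eventually_at_top_linorderI[of 2])
    fix k :: nat assume k: "2 \<le> k"
    then have "real (bp_size (B1 k)) \<le> real (C1 * k ^ M)" using B1[OF k] by (intro of_nat_mono) auto
    then show "norm (real (bp_size (B1 k))) \<le> real C1 * norm (real k powr ((real d - 1) * real h - real d + 2))"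
      unfolding powM[OF k] by simp
  qed
  have least1: "detFstates d h k \<le> bp_size (B1 k)" if "k \<ge> 2" for k
    unfolding detFstates_def using B1[OF that] by (intro Least_le exI[of _ "B1 k"]) simp
  have F: "(\<lambda>k. real (detFstates d h k)) \<in> O(\<lambda>k. real k powr ((real d - 1) * real h - real d + 2))"
    by (rule landau_o.big_trans[OF _ size1], rule bigoI[where c = 1], rule eventually_at_top_linorderI[of 2])
      (simp add: least1)

  obtain C3 where C3: "\<And>(k :: nat) q. 1 \<le> q \<Longrightarrow> k < q * q \<Longrightarrow> \<exists>B. ndet_solves_BT d h k B \<and>
      ndet_thrifty d h k B \<and> bp_size B \<le> C3 * q ^ ((d - 1) * h + 2)"
    using ndet_BT_program[OF assms] by blast
  define c where "c = real C3 * 2 ^ ((d - 1) * h + 2)"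
  let ?g = "\<lambda>k. real k powr ((real d - 1) * real h / 2 + 1)"
  have ex3: "\<exists>B. ndet_solves_BT d h k B \<and> ndet_thrifty d h k B \<and> real (bp_size B) \<le> c * ?g k"
    if k: "k \<ge> 2" for k
  proof -
    obtain q :: nat where q: "q \<ge> 1" "k < q * q" "real q \<le> 2 * sqrt (real k)"
      using nat_sqrt_base[of k] k by auto
    obtain B where B: "ndet_solves_BT d h k B" "ndet_thrifty d h k B" "bp_size B \<le> C3 * q ^ ((d - 1) * h + 2)"
      using C3[OF q(1,2)] by blast
    have "real (bp_size B) \<le> real (C3 * q ^ ((d - 1) * h + 2))" using B(3) by (rule of_nat_mono)
    also have "\<dots> = real C3 * real q ^ ((d - 1) * h + 2)" by simp
    also have "\<dots> \<le> real C3 * (2 ^ ((d - 1) * h + 2) * ?g k)"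
      by (intro mult_left_mono powN[OF q(3) k]) auto
    finally show ?thesis using B(1,2) unfolding c_def mult.assoc by blast
  qed
  define B3 where "B3 k = (SOME B. ndet_solves_BT d h k B \<and> ndet_thrifty d h k B \<and> real (bp_size B) \<le> c * ?g k)" for k
  have B3: "ndet_solves_BT d h k (B3 k) \<and> ndet_thrifty d h k (B3 k) \<and> real (bp_size (B3 k)) \<le> c * ?g k"
    if "k \<ge> 2" for k
    unfolding B3_def by (rule someI_ex[OF ex3[OF that]])
  have size3: "(\<lambda>k. real (bp_size (B3 k))) \<in> O(?g)"
    by (rule bigoI[where c = c], rule eventually_at_top_linorderI[of 2]) (use B3 in simp)
  have least3: "ndetBstates d h k \<le> bp_size (B3 k)" if "k \<ge> 2" for k
    unfolding ndetBstates_def using B3[OF that] by (intro Least_le exI[of _ "B3 k"]) simp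
  have N: "(\<lambda>k. real (ndetBstates d h k)) \<in> O(?g)"
    by (rule landau_o.big_trans[OF _ size3], rule bigoI[where c = 1], rule eventually_at_top_linorderI[of 2])
      (simp add: least3)

  have D: "(\<lambda>k. real (detBstates d h k))
        \<in> O(\<lambda>k. real k powr ((real d - 1) * real h - real d + 2) / log 2 (real k))" if h: "h \<ge> 3"
  proof -
    obtain K where K: "\<And>k b. 1 \<le> b \<Longrightarrow> 4 ^ b \<le> k \<Longrightarrow> \<exists>B. det_solves_BT d h k B \<and> b * bp_size B \<le> K * k ^ M"
      using det_BT_program[OF assms(1) h] unfolding M_def by blast
    show ?thesis
    proof (rule bigoI[where c = "4 * real K"], rule eventually_at_top_linorderI[of 4])
      fix k :: nat assume k: "4 \<le> k"
      \<comment> \<open>The block length is the largest \<open>b\<close> with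
        \<open>4 ^ b \<le> k\<close>, and it is positive as \<open>k\<close> is at least 4. Then the
        binary logarithm of \<open>k\<close> is below \<open>2 * (b + 1)\<close>, hence at most
        \<open>4 * b\<close>; this gives the factor 4 in the constant.\<close>
      obtain b where b: "4 ^ b \<le> k" "k < 4 ^ (b + 1)"
        using ex_power_ivl1[of 4 k] k by auto
      have b1: "b \<ge> 1" using b k by (cases b) auto
      obtain B where B: "det_solves_BT d h k B" "b * bp_size B \<le> K * k ^ M"
        using K[OF b1 b(1)] by blast
      have "detBstates d h k \<le> bp_size B"
        unfolding detBstates_def using B(1) by (intro Least_le exI[of _ B]) simp
      then have "b * detBstates d h k \<le> K * k ^ M"
        using B(2) mult_le_mono2 order_trans by blast
      then have bound: "real b * real (detBstates d h k) \<le> real K * real (k ^ M)"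
        by (simp only: of_nat_mult[symmetric] of_nat_le_iff)
      have log_pos: "log 2 (real k) > 0" using k by simp
      have "real k < real (4 ^ (b + 1))"
        using b(2) by (simp only: of_nat_less_iff)
      also have "\<dots> = 2 ^ (2 * (b + 1))"
        unfolding power_mult by simp
      finally have "log 2 (real k) < real (2 * (b + 1))"
        using k by (intro log_of_power_less) auto
      then have "log 2 (real k) \<le> 4 * real b" using b1 by simp
      then have "log 2 (real k) * real (detBstates d h k) \<le> 4 * real b * real (detBstates d h k)"
        by (rule mult_right_mono) simp
      also have "\<dots> \<le> 4 * real K * real (k ^ M)" using bound by simp
      finally have "real (detBstates d h k) \<le> 4 * real K * (real (k ^ M) / log 2 (real k))"
        using log_pos by (simp add: field_simps)
      then show "norm (real (detBstates d h k))
          \<le> 4 * real K * norm (real k powr ((real d - 1) * real h - real d + 2) / log 2 (real k))"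
        using log_pos k powM[of k] by simp
    qed
  qed

  show ?thesis
  proof (intro conjI impI)
    show "\<exists>B. (\<forall>k\<ge>2. det_solves_FT d h k (B k) \<and> det_thrifty d h k (B k)) \<and>
        (\<lambda>k. real (bp_size (B k))) \<in> O(\<lambda>k. real k powr ((real d - 1) * real h - real d + 2))"
      by (rule exI[of _ B1]) (simp add: B1 size1)
    show "\<exists>B. (\<forall>k\<ge>2. ndet_solves_BT d h k (B k) \<and> ndet_thrifty d h k (B k)) \<and>
        (\<lambda>k. real (bp_size (B k))) \<in> O(?g)"
      by (rule exI[of _ B3]) (simp add: B3 size3)
  qed (fact F D N)+
qed

end
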